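(* Let $f\in L^3(W)$ and $\beta>-d/2$. (a) Then $$\begin{aligned} \operatorname{Var} L_n(\beta) = {}& \frac{n(n-1)}{2} \int_{W^2} \mathbf{1}\{\|x-y\|\leq r_n\} \, \|x-y\|^{2\beta} \, f(x) \, f(y) \, \mathrm{d}(x,y)\\ & + n(n-1)(n-2) \int_{W} \bigg( \int_W \mathbf{1}\{\|x-y\|\leq r_n\} \, \|x-y\|^\beta \, f(y) \, \mathrm{d}y\bigg)^2 f(x) \, \mathrm{d}x\\ & - n(n-1)(n-3/2) \bigg( \int_{W^2} \mathbf{1}\{\|x-y\|\leq r_n\} \, \|x-y\|^{\beta} \, f(x) \, f(y) \, \mathrm{d}(x,y)\bigg)^2. \end{aligned}$$ (b) If $f\not\equiv\mathbf{1}_W$, then $$\lim_{n\to\infty}\frac{\operatorname{Var} L_n(\beta)}{\sigma^{(1)}_{\beta,f} n^2 r_n^{2\beta+d}+\sigma^{(2)}_{\beta,f} n^3 r_n^{2\beta+2d}}=1,$$ where $$\sigma^{(1)}_{\beta,f} := \frac{d\kappa_d}{2(2\beta+d)} \int_W f(x)^2 \, \mathrm{d}x \quad\text{and}\quad \sigma^{(2)}_{\beta,f} := \frac{d^2\kappa_d^2}{(\beta+d)^2} \bigg( \int_W f(x)^3 \, \mathrm{d}x - \bigg(\int_W f(x)^2 \, \mathrm{d}x \bigg)^2 \bigg).$$ (c) If $f\equiv\mathbf{1}_W$, $$\limsup_{r\to 0} \frac{\operatorname{Vol}(\{x\in W: d(x,\partial W)\leq r\})}{r}<\infty,$$ and $nr_n^{d+1}\to0$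 as $n\to\infty$, then $$\lim_{n\to\infty}\frac{\operatorname{Var} L_n(\beta)}{n^2 r_n^{2\beta+d}}=\frac{d\kappa_d}{2(2\beta+d)}.$$
   Context: Let $d\ge 1$ and let $W\subset\mathbb{R}^d$ be a measurable set with volume (Lebesgue measure) $\operatorname{Vol}(W)=1$. Let $f$ be a probability density on $\mathbb{R}^d$ whose support is contained in $W$. For $n\ge 2$ let $\mathscr{X}_n=\{X_1,\ldots,X_n\}$, where $X_1,\ldots,X_n$ are i.i.d. random vectors with density $f$. Let $(r_n)$ be a sequence of positive real numbers with $r_n\to0$ as $n\to\infty$. For $\beta\in\mathbb{R}$ define $$L_n(\beta):=\frac12\sum_{(x,y)\in\mathscr{X}^2_{n,\neq}}\mathbf{1}\{\|x-y\|\le r_n\}\,\|x-y\|^\beta,$$ where the sum is over all ordered pairs of distinct points of $\mathscr{X}_n$, $\|\cdot\|$ is the Euclidean norm and $\mathbf{1}\{\cdot\}$ is the indicator. $\kappa_d=\pi^{d/2}/\Gamma(d/2+1)$ is the volume of the $d$-dimensional unit ball. $L^p(W)$, $p>0$, is the space of measurable functions on $W$ for which the $p$-th power of the absolute value has finite Lebesgue integral. $\partial W$ is the boundary of $W$ and $d(x,A):=\inf_{y\in A}\|x-y\|$. For functions $g,h$ on $W$, $g\equiv h$ means $g=h$ almost everywhere on $W$, and $\mathbf{1}_W$ is the indicator function of $W$ (the uniform density).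
   Formalization: Part (b) additionally assumes that f is not the uniform density on a measurable subset A of W with Vol(A) < 1; for such f the second constant is zero and (b) can fail, e.g. W=[0,1], f=2 on [0,1/2], β=0, r_n=n^(-1/4). *)

theory Defs
  imports "HOL-Probability.Probability"
begin

definition Lp_on :: "real \<Rightarrow> 'a::euclidean_space set \<Rightarrow> ('a \<Rightarrow> real) set" where
  "Lp_on p W = {g. set_borel_measurable lebesgue W g \<and>
                   set_integrable lebesgue W (\<lambda>x. \<bar>g x\<bar> powr p)}"

definition prob_density :: "('a::euclidean_space \<Rightarrow> real) \<Rightarrow> bool" where
  "prob_density f \<longleftrightarrow>
     f \<in> borel_measurable borel \<and> (\<forall>x. 0 \<le> f x) \<and> (\<integral>\<^sup>+ x. ennreal (f x) \<partial>lborel) = 1"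

definition ae_eq_on :: "'a::euclidean_space set \<Rightarrow> ('a \<Rightarrow> real) \<Rightarrow> ('a \<Rightarrow> real) \<Rightarrow> bool" where
  "ae_eq_on W g h \<longleftrightarrow> (AE x in lebesgue. x \<in> W \<longrightarrow> g x = h x)"

text \<open>
  The second-order variance asymptotics for non-uniform densities rely on
  \<open>\<integral> f^3 - (\<integral> f^2)^2 > 0\<close> on \<open>W\<close>. This quantity is the variance of \<open>f(X)\<close> for \<open>X\<close>
  with density \<open>f\<close>. It vanishes not only for the uniform density on \<open>W\<close>, but for the uniform
  density on any subset of \<open>W\<close> of positive volume. The following predicate describes the densities
  other than the uniform density on \<open>W\<close> for which it vanishes.

  For them these asymptotics can fail because of boundary effects: for
  \<open>W = [0,1]\<close>, \<open>f = 2\<close> on \<open>[0,1/2]\<close> and \<open>0\<close> elsewhere, \<open>\<beta> = 0\<close> and \<open>r_n = n powr (-1/4)\<close>,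
  the variance is of exact order \<open>n^3 r_n^3\<close>, while the normalisation is \<open>2 n^2 r_n\<close>, so that
  the quotient tends to infinity. No density that is positive almost everywhere on \<open>W\<close>
  satisfies the predicate.
\<close>

definition uniform_on_smaller_subset ::
    "'a::euclidean_space set \<Rightarrow> ('a \<Rightarrow> real) \<Rightarrow> bool" where
  "uniform_on_smaller_subset W f \<longleftrightarrow>
     (\<exists>A. A \<in> sets lebesgue \<and> A \<subseteq> W \<and> measure lebesgue A < measure lebesgue W \<and>
          ae_eq_on W f (\<lambda>x. indicator A x / measure lebesgue A))"

definition point_sample :: "(nat \<Rightarrow> 'w \<Rightarrow> 'a) \<Rightarrow> nat \<Rightarrow> 'w \<Rightarrow> 'a set" where
  "point_sample X n \<omega> = (\<lambda>i. X i \<omega>) ` {1..n}"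

definition length_power :: "real \<Rightarrow> real \<Rightarrow> 'a::euclidean_space set \<Rightarrow> real" where
  "length_power \<beta> r P =
     1 / 2 * (\<Sum>(x, y) \<in> {(x, y). x \<in> P \<and> y \<in> P \<and> x \<noteq> y}.
                of_bool (norm (x - y) \<le> r) * norm (x - y) powr \<beta>)"

definition sigma1 :: "real \<Rightarrow> 'a::euclidean_space set \<Rightarrow> ('a \<Rightarrow> real) \<Rightarrow> real" where
  "sigma1 \<beta> W f =
     real DIM('a) * unit_ball_vol (real DIM('a)) / (2 * (2 * \<beta> + real DIM('a))) *
     (LINT x:W|lebesgue. f x ^ 2)"

definition sigma2 :: "real \<Rightarrow> 'a::euclidean_space set \<Rightarrow> ('a \<Rightarrow> real) \<Rightarrow> real" where
  "sigma2 \<beta> W f =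
     (real DIM('a))\<^sup>2 * (unit_ball_vol (real DIM('a)))\<^sup>2 / (\<beta> + real DIM('a))\<^sup>2 *
     ((LINT x:W|lebesgue. f x ^ 3) - (LINT x:W|lebesgue. f x ^ 2)\<^sup>2)"

end

theory Submission
  imports Defs "HOL-Real_Asymp.Real_Asymp"
begin

text \<open>
  Write \<open>k u = 1{\<parallel>u\<parallel> \<le> r} \<parallel>u\<parallel>\<^sup>\<beta>\<close>. Almost surely the sample points are distinct, and then
  \<open>L\<^sub>n(\<beta>)\<close> is half the sum of \<open>k (X\<^sub>i - X\<^sub>j)\<close> over the ordered index pairs with
  \<open>i \<noteq> j\<close>, a second-order U-statistic. The covariance of two summands depends only on how many
  indices they share: it is zero for none, the variance of \<open>x \<mapsto> E k (x - X)\<close> for one, and the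
  variance of \<open>k (X\<^sub>1 - X\<^sub>2)\<close> for two. Counting the pairs of each kind gives the exact variance
  (\<open>variance_pair_sum\<close>, \<open>variance_length_power\<close>) in terms of a pair integral with exponent
  \<open>2\<beta>\<close>, a triple integral and a pair integral with exponent \<open>\<beta>\<close>.

  For the asymptotics, substitute \<open>y = x + u\<close>. The pair integral becomes \<open>\<integral> k(u) c\<^sub>2(u) du\<close> with
  \<open>c\<^sub>2(u) = \<integral> f(x) f(x+u) dx\<close>, and the triple integral becomes
  \<open>\<integral>\<integral> k(u) k(v) c\<^sub>3(u,v) du dv\<close> with \<open>c\<^sub>3(u,v) = \<integral> f(x) f(x+u) f(x+v) dx\<close>. As
  \<open>k\<close> lives on a ball of radius \<open>r \<rightarrow> 0\<close> and has an explicit integral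
  (\<open>nn_integral_power_kernel\<close>), it suffices that \<open>c\<^sub>2\<close> and \<open>c\<^sub>3\<close> are continuous at the origin.
  The inequality of arithmetic and geometric means and
  translation invariance give \<open>c\<^sub>2 \<le> \<integral> f\<^sup>2\<close> and \<open>c\<^sub>3 \<le> \<integral> f\<^sup>3\<close>. In the other
  direction a product of nonnegative numbers is at least a power of their minimum, so that
  \<open>abc \<ge> a\<^sup>3 - \<bar>b\<^sup>3 - a\<^sup>3\<bar> - \<bar>c\<^sup>3 - a\<^sup>3\<bar>\<close>; hence \<open>c\<^sub>3\<close> falls short of
  \<open>\<integral> f\<^sup>3\<close> by at most two translation errors of \<open>f\<^sup>3\<close> in the mean, which tend to zero because
  \<open>f\<^sup>3\<close> is integrable (\<open>integral_abs_translate_diff_less\<close>). The same works for \<open>c\<^sub>2\<close> and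
  \<open>f\<^sup>2\<close>.

  If the variance \<open>\<integral> f\<^sup>3 - (\<integral> f\<^sup>2)\<^sup>2\<close> of \<open>f(X)\<close> is positive, both terms of the normalisation have
  positive coefficients, and the variance is the same combination with coefficients that converge to
  them. If
  that variance vanishes, \<open>f\<close> is constant on its support and hence the uniform density on \<open>W\<close> or on
  a smaller subset, which is the excluded case.

  For the uniform density on \<open>W\<close> the potential \<open>g(x) = \<integral> k(x-y) f(y) dy\<close> equals its upper bound
  \<open>\<integral> k\<close> at every point of \<open>W\<close> that is further than \<open>r\<close> from the boundary. The variance of
  \<open>g(X)\<close> is therefore at most \<open>(\<integral> k)\<^sup>2\<close> times the volume of the boundary layer, which is
  \<open>O(r)\<close>, and the cubic term of the variance is negligible when \<open>n r\<^sup>d\<^sup>+\<^sup>1 \<rightarrow> 0\<close>.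
\<close>

section \<open>Variance of a symmetric pair statistic of an i.i.d. sample\<close>

lemma integrable_mult_of_squares:
  fixes a b :: "'a \<Rightarrow> real"
  assumes [measurable]: "a \<in> borel_measurable M" "b \<in> borel_measurable M"
    and "integrable M (\<lambda>x. (a x)\<^sup>2)" "integrable M (\<lambda>x. (b x)\<^sup>2)"
  shows "integrable M (\<lambda>x. a x * b x)"
proof (rule Bochner_Integration.integrable_bound)
  show "integrable M (\<lambda>x. (a x)\<^sup>2 + (b x)\<^sup>2)" using assms by simp
  show "AE x in M. norm (a x * b x) \<le> norm ((a x)\<^sup>2 + (b x)\<^sup>2)"
  proof (rule AE_I2)
    fix x
    have "2 * \<bar>a x * b x\<bar> \<le> (a x)\<^sup>2 + (b x)\<^sup>2"
      using sum_squares_bound[of "\<bar>a x\<bar>" "\<bar>b x\<bar>"] by (simp add: abs_mult)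
    moreover have "0 \<le> \<bar>a x * b x\<bar>" by simp
    ultimately show "norm (a x * b x) \<le> norm ((a x)\<^sup>2 + (b x)\<^sup>2)" by simp
  qed
qed measurable

text \<open>The statistic of interest is the sum of \<open>h\<close> over ordered pairs of distinct indices. Square
  integrability of \<open>h\<close> for two independent copies makes all its covariances finite.\<close>

locale iid_pair_kernel = prob_space M
  for M :: "'a measure" +
  fixes X :: "'i \<Rightarrow> 'a \<Rightarrow> 'b" and N D :: "'b measure" and I :: "'i set" and h :: "'b \<Rightarrow> 'b \<Rightarrow> real"
  assumes finite_I: "finite I"
    and indep: "indep_vars (\<lambda>_. N) X I"
    and ident: "\<And>i. i \<in> I \<Longrightarrow> distr M N (X i) = D"
    and h_meas: "(\<lambda>(x, y). h x y) \<in> borel_measurable (N \<Otimes>\<^sub>M N)"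
    and h_sym: "\<And>x y. h x y = h y x"
    and h_sq: "integrable (D \<Otimes>\<^sub>M D) (\<lambda>(x, y). (h x y)\<^sup>2)"
begin

definition index_pairs :: "('i \<times> 'i) set" where
  "index_pairs = {p \<in> I \<times> I. fst p \<noteq> snd p}"

definition pair_value :: "'i \<times> 'i \<Rightarrow> 'a \<Rightarrow> real" where
  "pair_value p \<omega> = h (X (fst p) \<omega>) (X (snd p) \<omega>)"

definition kernel_mean :: real where
  "kernel_mean = (\<integral>z. (case z of (x, y) \<Rightarrow> h x y) \<partial>(D \<Otimes>\<^sub>M D))"

definition second_moment :: real where
  "second_moment = (\<integral>z. (case z of (x, y) \<Rightarrow> (h x y)\<^sup>2) \<partial>(D \<Otimes>\<^sub>M D))"

text \<open>The second moment of the projection \<open>x \<mapsto> E h(x, X)\<close>, which governs the summands that share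
  exactly one index.\<close>

definition projection_moment :: real where
  "projection_moment = (\<integral>x. (\<integral>y. h x y \<partial>D)\<^sup>2 \<partial>D)"

lemma index_pairs_iff: "p \<in> index_pairs \<longleftrightarrow> fst p \<in> I \<and> snd p \<in> I \<and> fst p \<noteq> snd p"
  by (cases p) (auto simp: index_pairs_def)

lemma index_pairsE:
  assumes "p \<in> index_pairs"
  obtains i j where "p = (i, j)" "i \<in> I" "j \<in> I" "i \<noteq> j"
  using assms by (cases p) (auto simp: index_pairs_iff)

lemma finite_index_pairs: "finite index_pairs"
  using finite_I by (auto simp: index_pairs_def)

lemma rv: "i \<in> I \<Longrightarrow> X i \<in> measurable M N"
  using indep by (auto simp: indep_vars_def)

lemma pair_value_meas: "p \<in> index_pairs \<Longrightarrow> pair_value p \<in> borel_measurable M"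
  using measurable_compose[OF measurable_Pair[OF rv rv] h_meas, of "fst p" "snd p"]
  by (simp add: index_pairs_iff pair_value_def[abs_def])

lemma D_prob: "i \<in> I \<Longrightarrow> prob_space D" and D_sets: "i \<in> I \<Longrightarrow> sets D = sets N"
proof -
  assume i: "i \<in> I"
  show "prob_space D" using prob_space_distr[OF rv[OF i]] ident[OF i] by simp
  show "sets D = sets N" using ident[OF i] by (metis sets_distr)
qed

text \<open>Functions of disjoint blocks of the variables have a product distribution. This is stated through
  distributions because the two blocks may be mapped into spaces of different types, whereas the
  predicate for two independent variables requires equal types.\<close>

lemma distr_Pair_disjoint:
  assumes AB: "A \<inter> B = {}" "A \<subseteq> I" "B \<subseteq> I"
    and u: "u \<in> measurable (PiM A (\<lambda>_. N)) S" and v: "v \<in> measurable (PiM B (\<lambda>_. N)) T"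
  defines "U \<equiv> \<lambda>\<omega>. u (restrict (\<lambda>i. X i \<omega>) A)" and "V \<equiv> \<lambda>\<omega>. v (restrict (\<lambda>i. X i \<omega>) B)"
  shows "distr M (S \<Otimes>\<^sub>M T) (\<lambda>\<omega>. (U \<omega>, V \<omega>)) = distr M S U \<Otimes>\<^sub>M distr M T V"
proof -
  let ?A = "\<lambda>\<omega>. restrict (\<lambda>i. X i \<omega>) A" and ?B = "\<lambda>\<omega>. restrict (\<lambda>i. X i \<omega>) B"
  have "indep_var (PiM A (\<lambda>_. N)) ?A (PiM B (\<lambda>_. N)) ?B"
    by (rule indep_var_restrict[OF indep AB])
  then have A: "?A \<in> measurable M (PiM A (\<lambda>_. N))" and B: "?B \<in> measurable M (PiM B (\<lambda>_. N))"
    and eq: "distr M (PiM A (\<lambda>_. N)) ?A \<Otimes>\<^sub>M distr M (PiM B (\<lambda>_. N)) ?B =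
      distr M (PiM A (\<lambda>_. N) \<Otimes>\<^sub>M PiM B (\<lambda>_. N)) (\<lambda>\<omega>. (?A \<omega>, ?B \<omega>))"
    unfolding indep_var_distribution_eq by auto
  interpret VT: prob_space "distr (distr M (PiM B (\<lambda>_. N)) ?B) T v"
    by (intro prob_space.prob_space_distr[OF prob_space_distr[OF B]]) (use v in auto)
  have "distr M S U \<Otimes>\<^sub>M distr M T V =
      distr (distr M (PiM A (\<lambda>_. N)) ?A) S u \<Otimes>\<^sub>M distr (distr M (PiM B (\<lambda>_. N)) ?B) T v"
    unfolding distr_distr[OF u A] distr_distr[OF v B] by (simp add: U_def V_def comp_def)
  also have "\<dots> = distr (distr M (PiM A (\<lambda>_. N)) ?A \<Otimes>\<^sub>M distr M (PiM B (\<lambda>_. N)) ?B) (S \<Otimes>\<^sub>M T)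
      (\<lambda>(x, y). (u x, v y))"
    by (rule pair_measure_distr) (use u v VT.sigma_finite_measure_axioms in auto)
  also have "\<dots> = distr M (S \<Otimes>\<^sub>M T) (\<lambda>\<omega>. (U \<omega>, V \<omega>))"
    unfolding eq using A B u v by (subst distr_distr) (auto simp: U_def V_def comp_def)
  finally show ?thesis by simp
qed

lemma distr_pair:
  assumes "i \<in> I" "j \<in> I" "i \<noteq> j"
  shows "distr M (N \<Otimes>\<^sub>M N) (\<lambda>\<omega>. (X i \<omega>, X j \<omega>)) = D \<Otimes>\<^sub>M D"
  using distr_Pair_disjoint[of "{i}" "{j}" "\<lambda>f. f i" N "\<lambda>f. f j" N] assms ident
  by (simp add: measurable_component_singleton)

lemma distr_triple:
  assumes "i \<in> I" "j \<in> I" "l \<in> I" "i \<noteq> j" "i \<noteq> l" "j \<noteq> l"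
  shows "distr M (N \<Otimes>\<^sub>M (N \<Otimes>\<^sub>M N)) (\<lambda>\<omega>. (X i \<omega>, X j \<omega>, X l \<omega>)) = D \<Otimes>\<^sub>M (D \<Otimes>\<^sub>M D)"
  using distr_Pair_disjoint[of "{i}" "{j, l}" "\<lambda>f. f i" N "\<lambda>f. (f j, f l)" "N \<Otimes>\<^sub>M N"]
    distr_pair[of j l] assms ident
  by (simp add: measurable_component_singleton measurable_Pair)

lemma pair_value_sq_integrable: "p \<in> index_pairs \<Longrightarrow> integrable M (\<lambda>\<omega>. (pair_value p \<omega>)\<^sup>2)"
proof -
  assume "p \<in> index_pairs"
  then obtain i j where p: "p = (i, j)" "i \<in> I" "j \<in> I" "i \<noteq> j" by (rule index_pairsE)
  have [measurable]: "X i \<in> measurable M N" "X j \<in> measurable M N" using p rv by auto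
  note [measurable] = h_meas
  have "integrable (distr M (N \<Otimes>\<^sub>M N) (\<lambda>\<omega>. (X i \<omega>, X j \<omega>))) (\<lambda>(x, y). (h x y)\<^sup>2)"
    using h_sq distr_pair p by simp
  then show ?thesis
    by (subst (asm) integrable_distr_eq) (auto simp: p pair_value_def)
qed

lemma pair_value_mult_integrable: "p \<in> index_pairs \<Longrightarrow> q \<in> index_pairs \<Longrightarrow> integrable M (\<lambda>\<omega>. pair_value p \<omega> * pair_value q \<omega>)"
  by (intro integrable_mult_of_squares pair_value_sq_integrable pair_value_meas)

lemma pair_value_integrable: "p \<in> index_pairs \<Longrightarrow> integrable M (pair_value p)"
  by (intro square_integrable_imp_integrable[OF pair_value_meas pair_value_sq_integrable])

lemma expectation_pair_value: "p \<in> index_pairs \<Longrightarrow> expectation (pair_value p) = kernel_mean"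
  and expectation_pair_value_sq: "p \<in> index_pairs \<Longrightarrow> expectation (\<lambda>\<omega>. (pair_value p \<omega>)\<^sup>2) = second_moment"
proof -
  assume "p \<in> index_pairs"
  then obtain i j where p: "p = (i, j)" "i \<in> I" "j \<in> I" "i \<noteq> j" by (rule index_pairsE)
  have [measurable]: "X i \<in> measurable M N" "X j \<in> measurable M N" using p rv by auto
  note [measurable] = h_meas
  show "expectation (pair_value p) = kernel_mean" "expectation (\<lambda>\<omega>. (pair_value p \<omega>)\<^sup>2) = second_moment"
    by (unfold kernel_mean_def second_moment_def distr_pair[symmetric, OF p(2-4)]; subst integral_distr; simp add: p(1) pair_value_def[abs_def])+
qed

text \<open>Conditionally on the shared variable, the two factors are independent with the same mean, so
  the product integrates to the square of the projection.\<close>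

lemma expectation_triple:
  assumes "i \<in> I" "j \<in> I" "l \<in> I" "i \<noteq> j" "i \<noteq> l" "j \<noteq> l"
  shows "expectation (\<lambda>\<omega>. pair_value (i, j) \<omega> * pair_value (i, l) \<omega>) = projection_moment"
proof -
  have [measurable]: "X i \<in> measurable M N" "X j \<in> measurable M N" "X l \<in> measurable M N"
    using assms rv by auto
  note [measurable] = h_meas
  interpret D: prob_space D using D_prob assms by auto
  interpret DD: pair_prob_space D D ..
  interpret DDD: pair_prob_space D "D \<Otimes>\<^sub>M D" ..
  note [measurable_cong] = D_sets[OF assms(1)]
  let ?F = "\<lambda>(x, y, z). h x y * h x z"
  have F_meas: "?F \<in> borel_measurable (N \<Otimes>\<^sub>M (N \<Otimes>\<^sub>M N))" by measurable
  have X_meas: "(\<lambda>\<omega>. (X i \<omega>, X j \<omega>, X l \<omega>)) \<in> measurable M (N \<Otimes>\<^sub>M (N \<Otimes>\<^sub>M N))" by measurable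
  have "integrable M (\<lambda>\<omega>. ?F (X i \<omega>, X j \<omega>, X l \<omega>))"
    using pair_value_mult_integrable[of "(i, j)" "(i, l)"] assms by (simp add: index_pairs_iff pair_value_def)
  then have "integrable (distr M (N \<Otimes>\<^sub>M (N \<Otimes>\<^sub>M N)) (\<lambda>\<omega>. (X i \<omega>, X j \<omega>, X l \<omega>))) ?F"
    unfolding integrable_distr_eq[OF X_meas F_meas] .
  then have F_int: "integrable (D \<Otimes>\<^sub>M (D \<Otimes>\<^sub>M D)) ?F"
    using distr_triple[OF assms] by simp
  have h_int: "integrable (D \<Otimes>\<^sub>M D) (\<lambda>(x, y). h x y)"
    by (rule DD.square_integrable_imp_integrable) (use h_sq in \<open>auto simp: case_prod_beta'\<close>)
  have "expectation (\<lambda>\<omega>. pair_value (i, j) \<omega> * pair_value (i, l) \<omega>) =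
      (\<integral>w. ?F w \<partial>distr M (N \<Otimes>\<^sub>M (N \<Otimes>\<^sub>M N)) (\<lambda>\<omega>. (X i \<omega>, X j \<omega>, X l \<omega>)))"
    unfolding integral_distr[OF X_meas F_meas] by (simp add: pair_value_def)
  also have "\<dots> = (\<integral>w. ?F w \<partial>(D \<Otimes>\<^sub>M (D \<Otimes>\<^sub>M D)))"
    using distr_triple[OF assms] by simp
  also have "\<dots> = (\<integral>x. (\<integral>w. ?F (x, w) \<partial>(D \<Otimes>\<^sub>M D)) \<partial>D)"
    using DDD.integral_fst'[OF F_int] by simp
  also have "\<dots> = projection_moment"
    unfolding projection_moment_def
  proof (rule integral_cong_AE)
    have "AE x in D. integrable (D \<Otimes>\<^sub>M D) (\<lambda>w. ?F (x, w))"
      using DDD.AE_integrable_fst'[OF F_int] .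
    moreover have "AE x in D. integrable D (\<lambda>y. h x y)"
      using DD.AE_integrable_fst'[OF h_int] by simp
    ultimately show "AE x in D. (\<integral>w. ?F (x, w) \<partial>(D \<Otimes>\<^sub>M D)) = (\<integral>y. h x y \<partial>D)\<^sup>2"
    proof eventually_elim
      case (elim x)
      have "(\<integral>w. ?F (x, w) \<partial>(D \<Otimes>\<^sub>M D)) = (\<integral>y. (\<integral>z. h x y * h x z \<partial>D) \<partial>D)"
        using DD.integral_fst'[OF elim(1)] by simp
      then show ?case by (simp add: power2_eq_square)
    qed
  qed measurable
  finally show ?thesis .
qed

lemma expectation_disjoint:
  assumes "p \<in> index_pairs" "q \<in> index_pairs" "{fst p, snd p} \<inter> {fst q, snd q} = {}"
  shows "expectation (\<lambda>\<omega>. pair_value p \<omega> * pair_value q \<omega>) = kernel_mean\<^sup>2"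
proof -
  note [measurable] = h_meas
  have meas: "(\<lambda>f. h (f (fst r)) (f (snd r))) \<in> borel_measurable (PiM {fst r, snd r} (\<lambda>_. N))" for r :: "'i \<times> 'i"
  proof -
    have "(\<lambda>f. f (fst r)) \<in> measurable (PiM {fst r, snd r} (\<lambda>_. N)) N"
      "(\<lambda>f. f (snd r)) \<in> measurable (PiM {fst r, snd r} (\<lambda>_. N)) N"
      by (rule measurable_component_singleton; simp)+
    from measurable_compose[OF measurable_Pair[OF this] h_meas] show ?thesis by simp
  qed
  have "indep_var (PiM {fst p, snd p} (\<lambda>_. N)) (\<lambda>\<omega>. restrict (\<lambda>i. X i \<omega>) {fst p, snd p})
      (PiM {fst q, snd q} (\<lambda>_. N)) (\<lambda>\<omega>. restrict (\<lambda>i. X i \<omega>) {fst q, snd q})"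
    by (rule indep_var_restrict[OF indep]) (use assms in \<open>auto simp: index_pairs_iff\<close>)
  then have "indep_var borel ((\<lambda>f. h (f (fst p)) (f (snd p))) \<circ> (\<lambda>\<omega>. restrict (\<lambda>i. X i \<omega>) {fst p, snd p}))
     borel ((\<lambda>f. h (f (fst q)) (f (snd q))) \<circ> (\<lambda>\<omega>. restrict (\<lambda>i. X i \<omega>) {fst q, snd q}))"
    by (rule indep_var_compose) (rule meas)+
  then have "indep_var borel (pair_value p) borel (pair_value q)" by (simp add: comp_def pair_value_def[abs_def])
  from indep_var_lebesgue_integral[OF this pair_value_integrable pair_value_integrable]
  show ?thesis using assms expectation_pair_value by (simp add: power2_eq_square)
qed

text \<open>The mixed second moment as one expression in indicators of coinciding indices, so that it can be
  summed over all pairs of pairs without splitting the index set. Two pairs that share both indices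
  satisfy two of the four coincidences; the coefficient of the last bracket corrects for this.\<close>

lemma expectation_pair_value_mult:
  assumes p: "p \<in> index_pairs" and q: "q \<in> index_pairs"
  shows "expectation (\<lambda>\<omega>. pair_value p \<omega> * pair_value q \<omega>) = kernel_mean\<^sup>2
    + (projection_moment - kernel_mean\<^sup>2) * (of_bool (fst q = fst p) + of_bool (snd q = fst p) + of_bool (fst q = snd p) + of_bool (snd q = snd p))
    + (second_moment - 2 * projection_moment + kernel_mean\<^sup>2) * (of_bool (q = p) + of_bool (q = prod.swap p))"
proof -
  obtain i j where pe: "p = (i, j)" and ij: "i \<in> I" "j \<in> I" "i \<noteq> j" using p by (rule index_pairsE)
  obtain k l where qe: "q = (k, l)" and kl: "k \<in> I" "l \<in> I" "k \<noteq> l" using q by (rule index_pairsE)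
  have s: "h (X a \<omega>) (X b \<omega>) = h (X b \<omega>) (X a \<omega>)" for a b \<omega> by (rule h_sym)
  consider "{i, j} \<inter> {k, l} = {}" | "k = i" "l = j" | "k = j" "l = i"
    | "k = i" "l \<noteq> j" "l \<noteq> i" | "k = j" "l \<noteq> i" "l \<noteq> j" | "l = i" "k \<noteq> j" "k \<noteq> i" | "l = j" "k \<noteq> i" "k \<noteq> j"
    using kl by blast
  then show ?thesis
  proof cases
    case 1
    then show ?thesis using expectation_disjoint[OF p q] by (auto simp: pe qe pair_value_def)
  next
    case 2
    then show ?thesis using expectation_pair_value_sq[OF p] ij by (auto simp: pe qe pair_value_def power2_eq_square)
  next
    case 3
    then show ?thesis using expectation_pair_value_sq[OF p] ij s[of j _ i] by (auto simp: pe qe pair_value_def power2_eq_square)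
  next
    case 4
    then show ?thesis using expectation_triple[of i j l] ij kl by (auto simp: pe qe pair_value_def)
  next
    case 5
    then show ?thesis using expectation_triple[of j i l] ij kl s[of j _ i] by (auto simp: pe qe pair_value_def)
  next
    case 6
    then show ?thesis using expectation_triple[of i j k] ij kl s[of k _ i] by (auto simp: pe qe pair_value_def)
  next
    case 7
    then show ?thesis using expectation_triple[of j i k] ij kl s[of j _ i] s[of k _ j] by (auto simp: pe qe pair_value_def)
  qed
qed

lemma sum_index_pairs_of_bool:
  assumes "i \<in> I"
  shows "(\<Sum>q\<in>index_pairs. of_bool (fst q = i) :: real) = real (card I) - 1"
    and "(\<Sum>q\<in>index_pairs. of_bool (snd q = i) :: real) = real (card I) - 1"
proof -
  have c: "real (card (I - {i})) = real (card I) - 1"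
    using assms finite_I card_gt_0_iff[of I] by (auto simp: of_nat_diff Suc_le_eq)
  have e: "index_pairs \<inter> {q. fst q = i} = {i} \<times> (I - {i})" "index_pairs \<inter> {q. snd q = i} = (I - {i}) \<times> {i}"
    using assms by (auto simp: index_pairs_def)
  show "(\<Sum>q\<in>index_pairs. of_bool (fst q = i) :: real) = real (card I) - 1"
    using finite_I c finite_index_pairs by (subst sum_of_bool_eq) (auto simp: e card_cartesian_product)
  show "(\<Sum>q\<in>index_pairs. of_bool (snd q = i) :: real) = real (card I) - 1"
    using finite_I c finite_index_pairs by (subst sum_of_bool_eq) (auto simp: e card_cartesian_product)
qed

lemma card_index_pairs: "real (card index_pairs) = real (card I) * (real (card I) - 1)"
proof -
  have "real (card index_pairs) = (\<Sum>q\<in>index_pairs. \<Sum>i\<in>I. of_bool (fst q = i))"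
    by (subst sum.cong[OF refl, where h="\<lambda>_. 1"]) (use finite_I in \<open>auto simp: of_bool_def index_pairs_iff\<close>)
  also have "\<dots> = (\<Sum>i\<in>I. \<Sum>q\<in>index_pairs. of_bool (fst q = i))" by (rule sum.swap)
  also have "\<dots> = real (card I) * (real (card I) - 1)" by (simp add: sum_index_pairs_of_bool)
  finally show ?thesis .
qed

lemma pair_sum_sq_integrable: "integrable M (\<lambda>\<omega>. (\<Sum>p\<in>index_pairs. pair_value p \<omega>)\<^sup>2)"
  unfolding power2_eq_square sum_product
  by (intro Bochner_Integration.integrable_sum pair_value_mult_integrable)

lemma variance_pair_sum:
  defines "n \<equiv> real (card I)"
  shows "variance (\<lambda>\<omega>. \<Sum>p\<in>index_pairs. pair_value p \<omega>) =
    n * (n - 1) * (2 * second_moment + 4 * (n - 2) * projection_moment - 4 * (n - 3 / 2) * kernel_mean\<^sup>2)"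
proof -
  have meas: "(\<lambda>\<omega>. \<Sum>p\<in>index_pairs. pair_value p \<omega>) \<in> borel_measurable M"
    by (intro borel_measurable_sum pair_value_meas)
  have E1: "expectation (\<lambda>\<omega>. \<Sum>p\<in>index_pairs. pair_value p \<omega>) = n * (n - 1) * kernel_mean"
    by (subst Bochner_Integration.integral_sum) (auto simp: pair_value_integrable expectation_pair_value card_index_pairs n_def)
  have inner: "(\<Sum>q\<in>index_pairs. expectation (\<lambda>\<omega>. pair_value p \<omega> * pair_value q \<omega>)) =
      n * (n - 1) * kernel_mean\<^sup>2 + (projection_moment - kernel_mean\<^sup>2) * (4 * (n - 1)) + (second_moment - 2 * projection_moment + kernel_mean\<^sup>2) * 2" if p: "p \<in> index_pairs" for p
  proof -
    have b: "(\<Sum>q\<in>index_pairs. of_bool (q = p) :: real) = 1" "(\<Sum>q\<in>index_pairs. of_bool (q = prod.swap p) :: real) = 1"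
      using p finite_index_pairs by (auto simp: of_bool_def index_pairs_iff)
    have "(\<Sum>q\<in>index_pairs. expectation (\<lambda>\<omega>. pair_value p \<omega> * pair_value q \<omega>)) =
      (\<Sum>q\<in>index_pairs. kernel_mean\<^sup>2
        + (projection_moment - kernel_mean\<^sup>2) * (of_bool (fst q = fst p) + of_bool (snd q = fst p) + of_bool (fst q = snd p) + of_bool (snd q = snd p))
        + (second_moment - 2 * projection_moment + kernel_mean\<^sup>2) * (of_bool (q = p) + of_bool (q = prod.swap p)))"
      by (rule sum.cong[OF refl]) (rule expectation_pair_value_mult[OF p])
    also have "\<dots> = n * (n - 1) * kernel_mean\<^sup>2 + (projection_moment - kernel_mean\<^sup>2) * (4 * (n - 1)) + (second_moment - 2 * projection_moment + kernel_mean\<^sup>2) * 2"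
      using p by (simp only: sum.distrib sum_distrib_left[symmetric] b sum_index_pairs_of_bool sum_constant card_index_pairs n_def
          index_pairs_iff) (simp add: algebra_simps)
    finally show ?thesis .
  qed
  have "expectation (\<lambda>\<omega>. (\<Sum>p\<in>index_pairs. pair_value p \<omega>)\<^sup>2) = (\<Sum>p\<in>index_pairs. \<Sum>q\<in>index_pairs. expectation (\<lambda>\<omega>. pair_value p \<omega> * pair_value q \<omega>))"
    unfolding power2_eq_square sum_product
    by (subst Bochner_Integration.integral_sum, intro Bochner_Integration.integrable_sum pair_value_mult_integrable, assumption+,
        intro sum.cong refl Bochner_Integration.integral_sum pair_value_mult_integrable)
  also have "\<dots> = n * (n - 1) * (n * (n - 1) * kernel_mean\<^sup>2 + (projection_moment - kernel_mean\<^sup>2) * (4 * (n - 1)) + (second_moment - 2 * projection_moment + kernel_mean\<^sup>2) * 2)"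
    by (subst sum.cong[OF refl inner]) (auto simp: card_index_pairs n_def)
  finally have E2: "expectation (\<lambda>\<omega>. (\<Sum>p\<in>index_pairs. pair_value p \<omega>)\<^sup>2) = \<dots>" .
  have "variance (\<lambda>\<omega>. \<Sum>p\<in>index_pairs. pair_value p \<omega>) = expectation (\<lambda>\<omega>. (\<Sum>p\<in>index_pairs. pair_value p \<omega>)\<^sup>2) - (expectation (\<lambda>\<omega>. \<Sum>p\<in>index_pairs. pair_value p \<omega>))\<^sup>2"
    by (rule variance_eq[OF square_integrable_imp_integrable[OF meas pair_sum_sq_integrable] pair_sum_sq_integrable])
  also have "\<dots> = n * (n - 1) * (2 * second_moment + 4 * (n - 2) * projection_moment - 4 * (n - 3 / 2) * kernel_mean\<^sup>2)"
    unfolding E1 E2 by (simp add: field_simps power2_eq_square)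
  finally show ?thesis .
qed

end

section \<open>Continuity of translations in the mean\<close>

lemma lborel_integral_translate:
  fixes g :: "'a::euclidean_space \<Rightarrow> real"
  assumes [measurable]: "g \<in> borel_measurable borel"
  shows "(LINT x|lborel. g (x + u)) = (LINT x|lborel. g x)"
proof -
  have "(LINT x|lborel. g x) = (LINT x|distr lborel borel ((+) u). g x)"
    by (simp add: lborel_distr_plus)
  also have "\<dots> = (LINT x|lborel. g (x + u))"
    by (subst integral_distr) (auto simp: add.commute)
  finally show ?thesis by simp
qed

lemma lborel_integrable_translate:
  fixes g :: "'a::euclidean_space \<Rightarrow> real"
  assumes "integrable lborel g"
  shows "integrable lborel (\<lambda>x. g (x + u))"
proof -
  have [measurable]: "g \<in> borel_measurable borel"
    using assms by auto
  have "integrable (distr lborel borel ((+) u)) g"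
    using assms by (simp add: lborel_distr_plus)
  then show ?thesis
    by (subst (asm) integrable_distr_eq) (auto simp: add.commute)
qed

lemma lborel_nn_integral_translate:
  fixes g :: "'a::euclidean_space \<Rightarrow> ennreal"
  assumes [measurable]: "g \<in> borel_measurable borel"
  shows "(\<integral>\<^sup>+x. g (x + u) \<partial>lborel) = (\<integral>\<^sup>+x. g x \<partial>lborel)"
proof -
  have "(\<integral>\<^sup>+x. g x \<partial>lborel) = (\<integral>\<^sup>+x. g x \<partial>distr lborel borel ((+) u))"
    by (simp add: lborel_distr_plus)
  also have "\<dots> = (\<integral>\<^sup>+x. g (x + u) \<partial>lborel)"
    by (subst nn_integral_distr) (auto simp: add.commute)
  finally show ?thesis by simp
qed

text \<open>The two sets \<open>A\<close> and \<open>A - u\<close> have the same measure, so the integral of the absolute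
  difference of their indicators is twice that of its positive part. Up to the measure of
  \<open>U - A\<close>, the positive part is controlled by an open superset \<open>U\<close>, and the points that
  an open set loses under a small translation vanish in the limit by dominated convergence.\<close>

lemma integral_abs_translate_diff_indicator:
  fixes u :: "nat \<Rightarrow> 'a::euclidean_space"
  assumes A: "A \<in> sets lborel" "emeasure lborel A < \<infinity>" and u: "u \<longlonglongrightarrow> 0"
  shows "(\<lambda>n. LINT x|lborel. \<bar>indicat_real A (x + u n) - indicat_real A x\<bar>) \<longlonglongrightarrow> 0"
proof (rule LIMSEQ_I)
  fix e :: real assume e: "e > 0"
  have [measurable]: "A \<in> sets borel" using A by simp
  obtain U where U: "open U" "A \<subseteq> U" "(U - A) \<in> lmeasurable"
      "emeasure lebesgue (U - A) < ennreal (e / 4)"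
    using sets_lebesgue_outer_open[of A "e/4"] e A by auto
  have [measurable]: "U \<in> sets borel" using U by auto
  have iA: "integrable lborel (indicat_real A)" using A by auto
  have iD: "integrable lborel (indicat_real (U - A))"
    using less_trans[OF U(4) ennreal_less_top] by (simp add: integrable_indicator_iff)
  have mD: "(LINT x|lborel. indicat_real (U - A) x) < e / 4"
  proof -
    have "emeasure lborel (U - A) < ennreal (e / 4)" using U(4) by simp
    moreover from this have "emeasure lborel (U - A) = ennreal (measure lborel (U - A))"
      by (intro emeasure_eq_ennreal_measure) auto
    ultimately have "measure lborel (U - A) < e / 4" by (simp add: ennreal_less_iff)
    then show ?thesis by simp
  qed
  define p where "p n x = max 0 (indicat_real U x - indicat_real U (x + u n))" for n x
  have [measurable]: "p n \<in> borel_measurable borel" for n unfolding p_def by measurable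
  have iU: "integrable lborel (indicat_real U)"
  proof -
    have "indicat_real U = (\<lambda>x. indicat_real A x + indicat_real (U - A) x)"
      using U by (intro ext) (auto simp: indicator_def)
    then show ?thesis using iA iD by simp
  qed
  have p0: "(\<lambda>n. p n x) \<longlonglongrightarrow> 0" for x
  proof (cases "x \<in> U")
    case True
    have "(\<lambda>n. x + u n) \<longlonglongrightarrow> x + 0" by (intro tendsto_intros u)
    then have "\<forall>\<^sub>F n in sequentially. x + u n \<in> U"
      using topological_tendstoD U(1) True by fastforce
    then have "\<forall>\<^sub>F n in sequentially. p n x = 0"
      by eventually_elim (simp add: p_def True)
    then show ?thesis by (rule tendsto_eventually)
  qed (simp add: p_def)
  have pb: "norm (p n x) \<le> indicat_real U x" for n x
    by (auto simp: p_def indicator_def)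
  have "(\<lambda>n. LINT x|lborel. p n x) \<longlonglongrightarrow> (LINT x::'a|lborel. 0)"
    by (rule integral_dominated_convergence[where w="indicat_real U"])
       (use p0 pb iU in auto)
  from order_tendstoD(2)[OF this, of "e / 4"]
  have "\<forall>\<^sub>F n in sequentially. (LINT x|lborel. p n x) < e / 4" using e by simp
  then obtain N where N: "\<And>n. n \<ge> N \<Longrightarrow> (LINT x|lborel. p n x) < e / 4"
    by (auto simp: eventually_sequentially)
  have ip: "integrable lborel (p n)" for n
    by (rule Bochner_Integration.integrable_bound[OF iU]) (use pb in auto)
  show "\<exists>N. \<forall>n\<ge>N. norm ((LINT x|lborel. \<bar>indicat_real A (x + u n) - indicat_real A x\<bar>) - 0) < e"
  proof (intro exI allI impI)
    fix n assume n: "n \<ge> N"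
    let ?d = "\<lambda>x. indicat_real A (x + u n) - indicat_real A x"
    have iAt: "integrable lborel (\<lambda>x. indicat_real A (x + u n))"
      using lborel_integrable_translate[OF iA] .
    have iDt: "integrable lborel (\<lambda>x. indicat_real (U - A) (x + u n))"
      using lborel_integrable_translate[OF iD] .
    have "(LINT x|lborel. \<bar>?d x\<bar>) \<le> (LINT x|lborel. 2 * (p n x + indicat_real (U - A) (x + u n)) + ?d x)"
    proof (rule integral_mono)
      \<comment> \<open>The summand \<open>?d x\<close> on the right has integral zero.\<close>
      show "\<bar>?d x\<bar> \<le> 2 * (p n x + indicat_real (U - A) (x + u n)) + ?d x" for x
        using U(2) by (auto simp: p_def indicator_def)
    qed (use iA iAt iDt ip in auto)
    also have "\<dots> = 2 * ((LINT x|lborel. p n x) + (LINT x|lborel. indicat_real (U - A) x))"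
      using iA iAt iDt ip by (simp add: lborel_integral_translate)
    also have "\<dots> < e" using N[OF n] mD by simp
    finally show "norm ((LINT x|lborel. \<bar>?d x\<bar>) - 0) < e" by simp
  qed
qed

text \<open>The property passes from indicators to all integrable functions because it is stable under sums
  and under limits in the mean.\<close>

lemma integral_abs_translate_diff_seq:
  fixes g :: "'a::euclidean_space \<Rightarrow> real" and u :: "nat \<Rightarrow> 'a"
  assumes g: "integrable lborel g" and u: "u \<longlonglongrightarrow> 0"
  shows "(\<lambda>n. LINT x|lborel. \<bar>g (x + u n) - g x\<bar>) \<longlonglongrightarrow> 0"
  using g
proof (induction rule: integrable_induct)
  case (base A c)
  have "(\<lambda>n. (LINT x|lborel. \<bar>indicat_real A (x + u n) - indicat_real A x\<bar>) * \<bar>c\<bar>) \<longlonglongrightarrow> 0 * \<bar>c\<bar>"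
    by (intro tendsto_intros integral_abs_translate_diff_indicator base u)
  then show ?case
    by (simp add: left_diff_distrib[symmetric] abs_mult)
next
  case (add f g)
  note i = add(1,2) lborel_integrable_translate[OF add(1)] lborel_integrable_translate[OF add(2)]
  have lim0: "(\<lambda>n. (LINT x|lborel. \<bar>f (x + u n) - f x\<bar>) + (LINT x|lborel. \<bar>g (x + u n) - g x\<bar>)) \<longlonglongrightarrow> 0"
    using tendsto_add[OF add(3,4)] by simp
  have bound: "norm (LINT x|lborel. \<bar>f (x + u n) + g (x + u n) - (f x + g x)\<bar>) \<le>
      (LINT x|lborel. \<bar>f (x + u n) - f x\<bar>) + (LINT x|lborel. \<bar>g (x + u n) - g x\<bar>)" for n
  proof -
    have "(LINT x|lborel. \<bar>f (x + u n) + g (x + u n) - (f x + g x)\<bar>) \<le>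
        (LINT x|lborel. \<bar>f (x + u n) - f x\<bar> + \<bar>g (x + u n) - g x\<bar>)"
      by (rule integral_mono) (auto simp: i)
    also have "\<dots> = (LINT x|lborel. \<bar>f (x + u n) - f x\<bar>) + (LINT x|lborel. \<bar>g (x + u n) - g x\<bar>)"
      by (intro Bochner_Integration.integral_add integrable_abs Bochner_Integration.integrable_diff i)
    finally show ?thesis by simp
  qed
  show ?case
    by (rule Lim_null_comparison[OF always_eventually lim0]) (intro allI bound)
next
  case (lim f s)
  have [measurable]: "f \<in> borel_measurable borel" "s i \<in> borel_measurable borel" for i
    using lim by auto
  have "(\<lambda>i. LINT x|lborel. \<bar>s i x - f x\<bar>) \<longlonglongrightarrow> (LINT x::'a|lborel. 0)"
  proof (rule integral_dominated_convergence[where w="\<lambda>x. 3 * norm (f x)"])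
    show "AE x in lborel. (\<lambda>i. \<bar>s i x - f x\<bar>) \<longlonglongrightarrow> 0"
    proof (rule AE_I2)
      show "(\<lambda>i. \<bar>s i x - f x\<bar>) \<longlonglongrightarrow> 0" for x
        by (intro tendsto_rabs_zero LIM_zero lim(2)) simp
    qed
    show "AE x in lborel. norm \<bar>s i x - f x\<bar> \<le> 3 * norm (f x)" for i
    proof (rule AE_I2)
      fix x show "norm \<bar>s i x - f x\<bar> \<le> 3 * norm (f x)" using lim(3)[of x i] by simp
    qed
    show "integrable lborel (\<lambda>x. 3 * norm (f x))"
      by (intro integrable_mult_right integrable_norm lim(4))
  qed measurable
  then have c: "(\<lambda>i. LINT x|lborel. \<bar>s i x - f x\<bar>) \<longlonglongrightarrow> 0" by simp
  show ?case
  proof (rule LIMSEQ_I)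
    fix e :: real assume e: "e > 0"
    obtain i where i: "(LINT x|lborel. \<bar>s i x - f x\<bar>) < e / 4"
      using order_tendstoD(2)[OF c, of "e/4"] e by (auto simp: eventually_sequentially)
    obtain N where N: "\<And>n. n \<ge> N \<Longrightarrow> (LINT x|lborel. \<bar>s i (x + u n) - s i x\<bar>) < e / 2"
      using order_tendstoD(2)[OF lim(5)[of i], of "e/2"] e by (auto simp: eventually_sequentially)
    show "\<exists>N. \<forall>n\<ge>N. norm ((LINT x|lborel. \<bar>f (x + u n) - f x\<bar>) - 0) < e"
    proof (intro exI allI impI)
      fix n assume n: "n \<ge> N"
      note I = lim(1)[of i] lim(4) lborel_integrable_translate[OF lim(1)[of i]]
        lborel_integrable_translate[OF lim(4)]
      have "(LINT x|lborel. \<bar>f (x + u n) - f x\<bar>) \<le>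
        (LINT x|lborel. \<bar>s i (x + u n) - f (x + u n)\<bar> + \<bar>s i (x + u n) - s i x\<bar> + \<bar>s i x - f x\<bar>)"
        by (rule integral_mono) (auto simp: I)
      also have "\<dots> = (LINT x|lborel. \<bar>s i (x + u n) - f (x + u n)\<bar>) +
          (LINT x|lborel. \<bar>s i (x + u n) - s i x\<bar>) + (LINT x|lborel. \<bar>s i x - f x\<bar>)"
        by (simp add: I)
      also have "(LINT x|lborel. \<bar>s i (x + u n) - f (x + u n)\<bar>) = (LINT x|lborel. \<bar>s i x - f x\<bar>)"
        by (rule lborel_integral_translate[where g="\<lambda>x. \<bar>s i x - f x\<bar>"]) measurable
      finally show "norm ((LINT x|lborel. \<bar>f (x + u n) - f x\<bar>) - 0) < e"
        using i N[OF n] by simp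
    qed
  qed
qed

lemma integral_abs_translate_diff_less:
  fixes g :: "'a::euclidean_space \<Rightarrow> real"
  assumes g: "integrable lborel g" and e: "e > 0"
  obtains \<delta> where "\<delta> > 0" "\<And>u. norm u < \<delta> \<Longrightarrow> (LINT x|lborel. \<bar>g (x + u) - g x\<bar>) < e"
proof -
  have "((\<lambda>u. LINT x|lborel. \<bar>g (x + u) - g x\<bar>) \<longlongrightarrow> 0) (at 0)"
    unfolding tendsto_at_iff_sequentially o_def
    by (intro allI impI integral_abs_translate_diff_seq[OF g])
  then have "\<forall>\<^sub>F u in at 0. (LINT x|lborel. \<bar>g (x + u) - g x\<bar>) < e"
    by (rule order_tendstoD) (rule e)
  then obtain \<delta> where \<delta>: "\<delta> > 0" "\<forall>u. u \<noteq> 0 \<and> norm u < \<delta> \<longrightarrow> (LINT x|lborel. \<bar>g (x + u) - g x\<bar>) < e"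
    by (auto simp: eventually_at)
  show thesis
  proof (rule that[OF \<delta>(1)])
    fix u :: 'a assume "norm u < \<delta>"
    then show "(LINT x|lborel. \<bar>g (x + u) - g x\<bar>) < e"
      using \<delta>(2) e by (cases "u = 0") auto
  qed
qed

section \<open>The power kernel and its mass\<close>

definition power_kernel :: "real \<Rightarrow> real \<Rightarrow> 'a::euclidean_space \<Rightarrow> real" where
  "power_kernel \<gamma> r u = of_bool (norm u \<le> r) * norm u powr \<gamma>"

lemma power_kernel_measurable [measurable]: "power_kernel \<gamma> r \<in> borel_measurable borel"
  unfolding power_kernel_def[abs_def] by measurable

lemma nn_integral_monomial_Icc:
  assumes "0 \<le> a" "a \<le> b" and that: "c \<ge> 0"
  shows "(\<integral>\<^sup>+t. ennreal (c * real (Suc m) * t ^ m) * indicator {a..b} t \<partial>lborel) = c * (b ^ Suc m - a ^ Suc m)"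
proof -
  have "(\<integral>\<^sup>+t. ennreal (c * real (Suc m) * t ^ m) * indicator {a..b} t \<partial>lborel) =
      ennreal (c * b ^ Suc m - c * a ^ Suc m)"
  proof (rule nn_integral_FTC_Icc)
    show "((\<lambda>t. c * t ^ Suc m) has_real_derivative c * real (Suc m) * x ^ m) (at x)" for x
      by (auto intro!: derivative_eq_intros simp: algebra_simps)
       (cases m; simp add: algebra_simps)
  qed (use assms that in auto)
  then show ?thesis by (simp add: algebra_simps)
qed

text \<open>Polar coordinates for radial functions: the image of Lebesgue measure on a ball under the norm has
  the density \<open>d \<kappa>\<^sub>d t\<^sup>d\<^sup>-\<^sup>1\<close>. Both measures give the half-line beyond \<open>x\<close> the
  volume of a spherical shell, and half-lines determine a finite measure.\<close>

lemma distr_norm_cball: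
  fixes r :: real
  assumes r: "r > 0"
  defines "d \<equiv> DIM('a::euclidean_space)" and "\<kappa> \<equiv> unit_ball_vol (real DIM('a))"
  shows "distr (density lborel (indicator (cball (0::'a) r))) borel norm =
    density lborel (\<lambda>t. ennreal (\<kappa> * real d * t ^ (d - 1)) * indicator {0..r} t)"
proof (rule measure_eqI_lessThan)
  have \<kappa>: "\<kappa> \<ge> 0" unfolding \<kappa>_def by simp
  obtain m where m: "d = Suc m" unfolding d_def by (metis DIM_positive gr0_conv_Suc)
  let ?M = "distr (density lborel (indicator (cball (0::'a) r))) borel norm"
  let ?N = "density lborel (\<lambda>t. ennreal (\<kappa> * real d * t ^ (d - 1)) * indicator {0..r} t)"
  have M: "emeasure ?M {x<..} = ennreal (if x < 0 then \<kappa> * r ^ d else \<kappa> * (r ^ d - min r x ^ d))" for x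
  proof -
    have "emeasure ?M {x<..} = emeasure lborel (cball (0::'a) r - {y. norm y \<le> x})"
    proof -
      have [measurable]: "norm -` {x<..} \<in> sets (borel :: 'a measure)"
        using measurable_sets[of norm borel "borel :: real measure" "{x<..}"] by simp
      have [measurable]: "cball (0::'a) r \<in> sets borel" by simp
      have "emeasure ?M {x<..} = emeasure (density lborel (indicator (cball (0::'a) r))) (norm -` {x<..})"
        by (simp add: emeasure_distr)
      also have "\<dots> = emeasure lborel (cball (0::'a) r \<inter> norm -` {x<..})"
        by (subst emeasure_density) (auto simp: indicator_inter_arith[symmetric])
      also have "cball (0::'a) r \<inter> norm -` {x<..} = cball 0 r - {y. norm y \<le> x}" by auto
      finally show ?thesis .
    qed
    also have "\<dots> = ennreal (if x < 0 then \<kappa> * r ^ d else \<kappa> * (r ^ d - min r x ^ d))"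
    proof (cases "x < 0")
      case True
      then have "{y::'a. norm y \<le> x} = {}" by (auto simp: not_le intro: less_le_trans)
      then show ?thesis using True r by (simp add: emeasure_cball \<kappa>_def d_def)
    next
      case False
      have "cball (0::'a) r - {y. norm y \<le> x} = cball 0 r - cball 0 (min r x)" by auto
      also have "emeasure lborel \<dots> = emeasure lborel (cball (0::'a) r) - emeasure lborel (cball (0::'a) (min r x))"
        using r False by (intro emeasure_Diff) (auto simp: emeasure_cball)
      also have "\<dots> = ennreal (\<kappa> * r ^ d - \<kappa> * min r x ^ d)"
        using r False \<kappa> by (simp add: emeasure_cball \<kappa>_def d_def ennreal_minus)
      finally show ?thesis using False by (simp add: algebra_simps)
    qed
    finally show ?thesis .
  qed
  have N: "emeasure ?N {x<..} = ennreal (if x < 0 then \<kappa> * r ^ d else \<kappa> * (r ^ d - min r x ^ d))" for x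
  proof -
    \<comment> \<open>Clamping \<open>x\<close> to \<open>[0, r]\<close> treats \<open>x < 0\<close> and \<open>x > r\<close> together with the main case.\<close>
    define y where "y = max 0 (min r x)"
    have y: "0 \<le> y" "y \<le> r" using r by (auto simp: y_def)
    have "emeasure ?N {x<..} = (\<integral>\<^sup>+t. ennreal (\<kappa> * real d * t ^ (d - 1)) * indicator {0..r} t * indicator {x<..} t \<partial>lborel)"
      by (simp add: emeasure_density)
    also have "\<dots> = (\<integral>\<^sup>+t. ennreal (\<kappa> * real (Suc m) * t ^ m) * indicator {y..r} t \<partial>lborel)"
    proof (rule nn_integral_cong_AE)
      have "AE t in lborel. t \<noteq> x" "AE t in lborel. t \<noteq> r" by (rule AE_lborel_singleton)+
      then show "AE t in lborel. ennreal (\<kappa> * real d * t ^ (d - 1)) * indicator {0..r} t * indicator {x<..} t =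
          ennreal (\<kappa> * real (Suc m) * t ^ m) * indicator {y..r} t"
        by eventually_elim (auto simp: indicator_def y_def m)
    qed
    also have "\<dots> = \<kappa> * (r ^ Suc m - y ^ Suc m)"
      by (rule nn_integral_monomial_Icc) (use y \<kappa> in auto)
    finally show ?thesis using r by (auto simp: m y_def)
  qed
  show "emeasure ?M {x<..} < \<infinity>" for x using M by simp
  show "emeasure ?M {x<..} = emeasure ?N {x<..}" for x using M N by simp
qed auto

text \<open>The integral of \<open>\<parallel>u\<parallel>\<^sup>\<gamma>\<close> over the unit ball of dimension \<open>d\<close>; the integral over the ball of
  radius \<open>r\<close> is \<open>kernel_mass\<close>.\<close>

definition ball_moment :: "nat \<Rightarrow> real \<Rightarrow> real" where
  "ball_moment d \<gamma> = real d * unit_ball_vol (real d) / (\<gamma> + real d)"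

definition kernel_mass :: "nat \<Rightarrow> real \<Rightarrow> real \<Rightarrow> real" where
  "kernel_mass d \<gamma> r = ball_moment d \<gamma> * r powr (\<gamma> + real d)"

lemma nn_integral_power_kernel:
  assumes r: "r > 0" and \<gamma>: "\<gamma> > - real DIM('a::euclidean_space)"
  shows "(\<integral>\<^sup>+u. ennreal (power_kernel \<gamma> r (u::'a)) \<partial>lborel) =
    ennreal (kernel_mass DIM('a) \<gamma> r)"
proof -
  let ?d = "DIM('a)" and ?\<kappa> = "unit_ball_vol (real DIM('a))"
  have [measurable]: "cball (0::'a) r \<in> sets borel" by simp
  have "(\<integral>\<^sup>+u. ennreal (power_kernel \<gamma> r (u::'a)) \<partial>lborel) =
      (\<integral>\<^sup>+t. ennreal (t powr \<gamma>) \<partial>distr (density lborel (indicator (cball (0::'a) r))) borel norm)"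
    by (subst nn_integral_distr, simp, simp, subst nn_integral_density)
       (measurable, auto simp: power_kernel_def indicator_def intro!: nn_integral_cong)
  also have "\<dots> = (\<integral>\<^sup>+t. ennreal (?\<kappa> * real ?d * t ^ (?d - 1)) * indicator {0..r} t * ennreal (t powr \<gamma>) \<partial>lborel)"
    unfolding distr_norm_cball[OF r] by (subst nn_integral_density) auto
  also have "\<dots> = (\<integral>\<^sup>+t. ennreal (?\<kappa> * real ?d) * (ennreal (t powr (\<gamma> + ?d - 1)) * indicator {0..r} t) \<partial>lborel)"
  proof (rule nn_integral_cong_AE)
    have "AE t::real in lborel. t \<noteq> 0" by (rule AE_lborel_singleton)
    then show "AE t in lborel. ennreal (?\<kappa> * real ?d * t ^ (?d - 1)) * indicator {0..r} t * ennreal (t powr \<gamma>)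
       = ennreal (?\<kappa> * real ?d) * (ennreal (t powr (\<gamma> + ?d - 1)) * indicator {0..r} t)"
    proof eventually_elim
      case (elim t)
      show ?case
      proof (cases "t \<in> {0..r}")
        case True
        then have t: "t > 0" using elim by auto
        have "t ^ (?d - 1) * t powr \<gamma> = t powr (\<gamma> + ?d - 1)"
          using t by (simp add: powr_realpow[symmetric] powr_add[symmetric] algebra_simps of_nat_diff Suc_le_eq)
        then show ?thesis using True t
          by (simp add: ennreal_mult[symmetric] mult.assoc)
      qed simp
    qed
  qed
  also have "\<dots> = ennreal (?\<kappa> * real ?d) * ennreal (r powr (\<gamma> + ?d - 1 + 1) / (\<gamma> + ?d - 1 + 1))"
    by (subst nn_integral_cmult, measurable,
        subst nn_integral_has_integral_lebesgue'[OF _ has_integral_powr_from_0]) (use \<gamma> r in auto)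
  also have "\<dots> = ennreal (kernel_mass DIM('a) \<gamma> r)"
    by (subst ennreal_mult'[symmetric]) (auto simp: kernel_mass_def ball_moment_def mult_ac)
  finally show ?thesis .
qed

lemma power_kernel_nonneg [simp]: "power_kernel \<gamma> r u \<ge> 0"
  by (simp add: power_kernel_def)

lemma power_kernel_minus: "power_kernel \<gamma> r (- u) = power_kernel \<gamma> r u"
  by (simp add: power_kernel_def)

lemma power_kernel_commute: "power_kernel \<gamma> r (x - y) = power_kernel \<gamma> r (y - x)"
  by (simp add: power_kernel_def norm_minus_commute)

lemma power_kernel_square: "(power_kernel \<gamma> r u)\<^sup>2 = power_kernel (2 * \<gamma>) r u"
  by (auto simp: power_kernel_def power_mult_distrib power2_eq_square powr_add[symmetric])

lemma kernel_mass_nonneg: "\<gamma> > - real d \<Longrightarrow> 0 \<le> kernel_mass d \<gamma> r"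
  by (simp add: kernel_mass_def ball_moment_def)

lemma kernel_translate:
  fixes x :: "'a::euclidean_space"
  assumes r: "r > 0" and \<gamma>: "\<gamma> > - real DIM('a)"
  shows "integrable lborel (\<lambda>y. power_kernel \<gamma> r (x - y))"
    and "(LINT y|lborel. power_kernel \<gamma> r (x - y)) = kernel_mass DIM('a) \<gamma> r"
proof -
  have e: "(\<integral>\<^sup>+y. ennreal (power_kernel \<gamma> r (x - y)) \<partial>lborel) = ennreal (kernel_mass DIM('a) \<gamma> r)"
    using nn_integral_power_kernel[where 'a='a, OF r \<gamma>]
    by (subst lborel_nn_integral_translate[of _ x, symmetric]) (auto simp: power_kernel_minus)
  show i: "integrable lborel (\<lambda>y. power_kernel \<gamma> r (x - y))"
    using e by (intro integrableI_nonneg) auto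
  show "(LINT y|lborel. power_kernel \<gamma> r (x - y)) = kernel_mass DIM('a) \<gamma> r"
    using nn_integral_eq_integral[OF i] e kernel_mass_nonneg[OF \<gamma>, of r] by simp
qed

lemma nn_double_kernel:
  assumes r: "r > 0" and \<gamma>: "\<gamma> > - real DIM('a::euclidean_space)" and c: "c \<ge> 0"
  shows "(\<integral>\<^sup>+u. \<integral>\<^sup>+v. ennreal (power_kernel \<gamma> r u) * (ennreal (power_kernel \<gamma> r v) * ennreal c)
    \<partial>(lborel :: 'a measure) \<partial>(lborel :: 'a measure)) = ennreal ((kernel_mass DIM('a) \<gamma> r)\<^sup>2 * c)"
proof -
  let ?k = "\<lambda>u::'a. ennreal (power_kernel \<gamma> r u)" and ?K = "kernel_mass DIM('a) \<gamma> r"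
  have 1: "(\<integral>\<^sup>+v. ?k v * a \<partial>lborel) = ennreal ?K * a" for a
    by (subst nn_integral_multc, measurable) (simp add: nn_integral_power_kernel[OF r \<gamma>])
  have "(\<integral>\<^sup>+u. \<integral>\<^sup>+v. ?k u * (?k v * ennreal c) \<partial>lborel \<partial>lborel) = (\<integral>\<^sup>+u. ?k u * (ennreal ?K * ennreal c) \<partial>lborel)"
    by (subst nn_integral_cmult, measurable) (simp add: 1)
  also have "\<dots> = ennreal (?K\<^sup>2 * c)"
    unfolding 1 using kernel_mass_nonneg[OF \<gamma>, of r] c
    by (simp add: ennreal_mult'[symmetric] power2_eq_square mult.assoc)
  finally show ?thesis .
qed

section \<open>Pair and triple integrals of a density\<close>

lemma mult_le_mean_squares: "a * b \<le> (a\<^sup>2 + b\<^sup>2) / 2" for a b :: real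
  using sum_squares_bound[of a b] by simp

text \<open>The product is at least the square of the smaller factor, and that square differs from
  \<open>a\<^sup>2\<close> by at most the subtracted term. The cubic version below has the same reason.\<close>

lemma mult_ge_square_diff:
  fixes a b :: real
  assumes "a \<ge> 0" "b \<ge> 0"
  shows "a\<^sup>2 - \<bar>b\<^sup>2 - a\<^sup>2\<bar> \<le> a * b"
proof (cases "a \<le> b")
  case True
  then have "a\<^sup>2 \<le> a * b" using assms by (simp add: power2_eq_square mult_left_mono)
  then show ?thesis by linarith
next
  case False
  then have "b\<^sup>2 \<le> a * b" using assms by (simp add: power2_eq_square mult_right_mono)
  then show ?thesis by linarith
qed

lemma mult_le_mean_cubes:
  fixes a b c :: real
  assumes "a \<ge> 0" "b \<ge> 0" "c \<ge> 0"
  shows "a * b * c \<le> (a ^ 3 + b ^ 3 + c ^ 3) / 3"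
proof -
  have "a ^ 3 + b ^ 3 + c ^ 3 - 3 * (a * b * c) = (a + b + c) / 2 * ((a - b)\<^sup>2 + (b - c)\<^sup>2 + (c - a)\<^sup>2)"
    by (simp add: field_simps power2_eq_square power3_eq_cube)
  moreover have "\<dots> \<ge> 0" using assms by (intro mult_nonneg_nonneg) auto
  ultimately show ?thesis by simp
qed

lemma mult_ge_cube_diff:
  fixes a b c :: real
  assumes "a \<ge> 0" "b \<ge> 0" "c \<ge> 0"
  shows "a ^ 3 - \<bar>b ^ 3 - a ^ 3\<bar> - \<bar>c ^ 3 - a ^ 3\<bar> \<le> a * b * c"
proof -
  have m: "m ^ 3 \<le> a * b * c" if "0 \<le> m" "m \<le> a" "m \<le> b" "m \<le> c" for m
  proof -
    have "m * m * m \<le> a * b * c" using that assms by (intro mult_mono mult_nonneg_nonneg) auto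
    then show ?thesis by (simp add: power3_eq_cube)
  qed
  consider "a \<le> b" "a \<le> c" | "b \<le> a" "b \<le> c" | "c \<le> a" "c \<le> b" by linarith
  then show ?thesis
  proof cases
    case 1 then show ?thesis using m[of a] assms by linarith
  next
    case 2 then show ?thesis using m[of b] assms by linarith
  next
    case 3 then show ?thesis using m[of c] assms by linarith
  qed
qed

locale square_cube_integrable =
  fixes f :: "'a::euclidean_space \<Rightarrow> real"
  assumes f_meas [measurable]: "f \<in> borel_measurable borel"
    and f_nonneg: "\<And>x. 0 \<le> f x"
    and f_sq: "integrable lborel (\<lambda>x. (f x)\<^sup>2)"
    and f_cube: "integrable lborel (\<lambda>x. f x ^ 3)"
begin

definition sq_integral :: real where "sq_integral = (LINT x|lborel. (f x)\<^sup>2)"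
definition cube_integral :: real where "cube_integral = (LINT x|lborel. f x ^ 3)"

definition pair_integral :: "real \<Rightarrow> real \<Rightarrow> real" where
  "pair_integral \<gamma> r = (LINT (x, y)|(lborel \<Otimes>\<^sub>M lborel). power_kernel \<gamma> r (x - y) * f x * f y)"

text \<open>Named after the potential of a charge density: for \<open>X\<close> with density \<open>f\<close> this is the
  expectation of the kernel at \<open>x - X\<close>, the projection of the pair kernel to one variable.\<close>

definition potential :: "real \<Rightarrow> real \<Rightarrow> 'a \<Rightarrow> real" where
  "potential \<gamma> r x = (LINT y|lborel. power_kernel \<gamma> r (x - y) * f y)"

definition triple_integral :: "real \<Rightarrow> real \<Rightarrow> real" where
  "triple_integral \<gamma> r = (LINT x|lborel. (potential \<gamma> r x)\<^sup>2 * f x)"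

text \<open>The correlation integrals of the density with its translates, which carry the dependence of the pair
  and triple integrals on \<open>f\<close> after substituting differences.\<close>

definition corr2 :: "'a \<Rightarrow> real" where
  "corr2 u = (LINT x|lborel. f x * f (x + u))"

definition corr3 :: "'a \<Rightarrow> 'a \<Rightarrow> real" where
  "corr3 u v = (LINT x|lborel. f x * f (x + u) * f (x + v))"

lemma corr2_measurable [measurable]: "corr2 \<in> borel_measurable borel"
  unfolding corr2_def[abs_def] by measurable

lemma sq_translate: "integrable lborel (\<lambda>x. (f (x + u))\<^sup>2)" "(LINT x|lborel. (f (x + u))\<^sup>2) = sq_integral"
  using lborel_integrable_translate[OF f_sq] lborel_integral_translate[of "\<lambda>x. (f x)\<^sup>2" u]
  by (auto simp: sq_integral_def)

lemma cube_translate: "integrable lborel (\<lambda>x. f (x + u) ^ 3)" "(LINT x|lborel. f (x + u) ^ 3) = cube_integral"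
  using lborel_integrable_translate[OF f_cube] lborel_integral_translate[of "\<lambda>x. f x ^ 3" u]
  by (auto simp: cube_integral_def)

lemma corr2_integrable: "integrable lborel (\<lambda>x. f x * f (x + u))"
proof (rule Bochner_Integration.integrable_bound)
  show "integrable lborel (\<lambda>x. ((f x)\<^sup>2 + (f (x + u))\<^sup>2) / 2)"
    using f_sq sq_translate by simp
  show "AE x in lborel. norm (f x * f (x + u)) \<le> norm (((f x)\<^sup>2 + (f (x + u))\<^sup>2) / 2)"
    using mult_le_mean_squares f_nonneg by (intro AE_I2) (simp add: abs_of_nonneg)
qed measurable

lemma corr3_integrable: "integrable lborel (\<lambda>x. f x * f (x + u) * f (x + v))"
proof (rule Bochner_Integration.integrable_bound)
  show "integrable lborel (\<lambda>x. (f x ^ 3 + f (x + u) ^ 3 + f (x + v) ^ 3) / 3)"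
    using f_cube cube_translate by simp
  show "AE x in lborel. norm (f x * f (x + u) * f (x + v)) \<le> norm ((f x ^ 3 + f (x + u) ^ 3 + f (x + v) ^ 3) / 3)"
    using mult_le_mean_cubes f_nonneg by (intro AE_I2) (simp add: abs_of_nonneg)
qed measurable

lemma corr2_le: "corr2 u \<le> sq_integral"
proof -
  have "corr2 u \<le> (LINT x|lborel. ((f x)\<^sup>2 + (f (x + u))\<^sup>2) / 2)"
    unfolding corr2_def using f_sq sq_translate corr2_integrable
    by (intro integral_mono mult_le_mean_squares) auto
  also have "\<dots> = sq_integral" using f_sq sq_translate by (simp add: sq_integral_def[symmetric])
  finally show ?thesis .
qed

lemma corr3_le: "corr3 u v \<le> cube_integral"
proof -
  have "corr3 u v \<le> (LINT x|lborel. (f x ^ 3 + f (x + u) ^ 3 + f (x + v) ^ 3) / 3)"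
    unfolding corr3_def using f_cube cube_translate corr3_integrable
    by (intro integral_mono mult_le_mean_cubes f_nonneg) auto
  also have "\<dots> = cube_integral" using f_cube cube_translate by (simp add: cube_integral_def[symmetric])
  finally show ?thesis .
qed

lemma corr2_ge: "sq_integral - (LINT x|lborel. \<bar>(f (x + u))\<^sup>2 - (f x)\<^sup>2\<bar>) \<le> corr2 u"
proof -
  have "(LINT x|lborel. (f x)\<^sup>2 - \<bar>(f (x + u))\<^sup>2 - (f x)\<^sup>2\<bar>) \<le> corr2 u"
    unfolding corr2_def using f_sq sq_translate corr2_integrable
    by (intro integral_mono mult_ge_square_diff f_nonneg) auto
  then show ?thesis using f_sq sq_translate by (simp add: sq_integral_def)
qed

lemma corr3_ge:
  "cube_integral - (LINT x|lborel. \<bar>f (x + u) ^ 3 - f x ^ 3\<bar>) - (LINT x|lborel. \<bar>f (x + v) ^ 3 - f x ^ 3\<bar>) \<le> corr3 u v"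
proof -
  have "(LINT x|lborel. f x ^ 3 - \<bar>f (x + u) ^ 3 - f x ^ 3\<bar> - \<bar>f (x + v) ^ 3 - f x ^ 3\<bar>) \<le> corr3 u v"
    unfolding corr3_def using f_cube cube_translate corr3_integrable
    by (intro integral_mono mult_ge_cube_diff f_nonneg) auto
  then show ?thesis using f_cube cube_translate by (simp add: cube_integral_def)
qed

lemma integrals_nonneg: "0 \<le> sq_integral" "0 \<le> cube_integral"
  unfolding sq_integral_def cube_integral_def using f_nonneg by auto

lemma nn_pair_integral:
  "(\<integral>\<^sup>+z. ennreal (case z of (x, y) \<Rightarrow> power_kernel \<gamma> r (x - y) * f x * f y) \<partial>(lborel \<Otimes>\<^sub>M lborel)) =
   (\<integral>\<^sup>+u. ennreal (power_kernel \<gamma> r u) * ennreal (corr2 u) \<partial>lborel)"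
proof -
  have "(\<integral>\<^sup>+z. ennreal (case z of (x, y) \<Rightarrow> power_kernel \<gamma> r (x - y) * f x * f y) \<partial>(lborel \<Otimes>\<^sub>M lborel)) =
      (\<integral>\<^sup>+x. \<integral>\<^sup>+y. ennreal (power_kernel \<gamma> r (x - y) * f x * f y) \<partial>lborel \<partial>lborel)"
    by (subst lborel.nn_integral_fst[symmetric]) auto
  also have "\<dots> = (\<integral>\<^sup>+x. \<integral>\<^sup>+u. ennreal (power_kernel \<gamma> r u * f x * f (x + u)) \<partial>lborel \<partial>lborel)"
  proof (rule nn_integral_cong)
    fix x
    show "(\<integral>\<^sup>+y. ennreal (power_kernel \<gamma> r (x - y) * f x * f y) \<partial>lborel) =
        (\<integral>\<^sup>+u. ennreal (power_kernel \<gamma> r u * f x * f (x + u)) \<partial>lborel)"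
      by (subst lborel_nn_integral_translate[of _ x, symmetric])
         (auto simp: power_kernel_minus add.commute)
  qed
  also have "\<dots> = (\<integral>\<^sup>+u. \<integral>\<^sup>+x. ennreal (power_kernel \<gamma> r u * f x * f (x + u)) \<partial>lborel \<partial>lborel)"
    by (rule lborel_pair.Fubini') measurable
  also have "\<dots> = (\<integral>\<^sup>+u. ennreal (power_kernel \<gamma> r u) * ennreal (corr2 u) \<partial>lborel)"
  proof (rule nn_integral_cong)
    fix u
    have "(\<integral>\<^sup>+x. ennreal (power_kernel \<gamma> r u * f x * f (x + u)) \<partial>lborel) =
        (\<integral>\<^sup>+x. ennreal (power_kernel \<gamma> r u) * ennreal (f x * f (x + u)) \<partial>lborel)"
      by (simp add: ennreal_mult'[symmetric] mult.assoc)
    also have "\<dots> = ennreal (power_kernel \<gamma> r u) * (\<integral>\<^sup>+x. ennreal (f x * f (x + u)) \<partial>lborel)"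
      by (rule nn_integral_cmult) measurable
    also have "(\<integral>\<^sup>+x. ennreal (f x * f (x + u)) \<partial>lborel) = ennreal (corr2 u)"
      unfolding corr2_def by (rule nn_integral_eq_integral[OF corr2_integrable]) (simp add: f_nonneg)
    finally show "(\<integral>\<^sup>+x. ennreal (power_kernel \<gamma> r u * f x * f (x + u)) \<partial>lborel) =
       ennreal (power_kernel \<gamma> r u) * ennreal (corr2 u)" .
  qed
  finally show ?thesis .
qed

text \<open>The pair integral is the integral of \<open>corr2\<close> against a kernel supported in the ball of radius
  \<open>r\<close>, so bounds on \<open>corr2\<close> there are inherited, multiplied by the mass of the kernel. The
  number \<open>e\<close> bounds the translation error of \<open>f\<^sup>2\<close> in the mean.\<close>

lemma pair_integrable_and_bounds:
  assumes r: "r > 0" and \<gamma>: "\<gamma> > - real DIM('a)"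
  shows pair_integrable: "integrable (lborel \<Otimes>\<^sub>M lborel) (\<lambda>(x, y). power_kernel \<gamma> r (x - y) * f x * f y)"
    and pair_integral_le: "pair_integral \<gamma> r \<le> kernel_mass DIM('a) \<gamma> r * sq_integral"
    and pair_integral_ge: "(\<And>u. norm u \<le> r \<Longrightarrow> (LINT x|lborel. \<bar>(f (x + u))\<^sup>2 - (f x)\<^sup>2\<bar>) \<le> e) \<Longrightarrow>
      kernel_mass DIM('a) \<gamma> r * (sq_integral - e) \<le> pair_integral \<gamma> r"
proof -
  let ?G = "\<lambda>(x, y). power_kernel \<gamma> r (x - y) * f x * f y"
  let ?N = "\<integral>\<^sup>+u. ennreal (power_kernel \<gamma> r u) * ennreal (corr2 u) \<partial>lborel"
  have G0: "0 \<le> ?G z" for z using f_nonneg by (auto split: prod.split)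
  have "?N \<le> (\<integral>\<^sup>+u. ennreal (power_kernel \<gamma> r u) * ennreal sq_integral \<partial>(lborel :: 'a measure))"
    by (intro nn_integral_mono mult_left_mono ennreal_leI corr2_le) auto
  also have "\<dots> = ennreal (kernel_mass DIM('a) \<gamma> r) * ennreal sq_integral"
    by (subst nn_integral_multc, measurable, subst nn_integral_power_kernel[OF r \<gamma>]) (rule refl)
  finally have up: "?N \<le> ennreal (kernel_mass DIM('a) \<gamma> r * sq_integral)"
    using kernel_mass_nonneg[OF \<gamma>] by (simp add: ennreal_mult'[symmetric])
  show I: "integrable (lborel \<Otimes>\<^sub>M lborel) ?G"
  proof (rule integrableI_nonneg)
    show "(\<integral>\<^sup>+z. ennreal (?G z) \<partial>(lborel \<Otimes>\<^sub>M lborel)) < \<infinity>"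
      using le_less_trans[OF up ennreal_less_top] unfolding nn_pair_integral by simp
  qed (use G0 in auto)
  have eq: "ennreal (pair_integral \<gamma> r) = ?N"
    unfolding pair_integral_def using nn_integral_eq_integral[OF I] G0 nn_pair_integral by simp
  have nn: "pair_integral \<gamma> r \<ge> 0"
    unfolding pair_integral_def by (rule Bochner_Integration.integral_nonneg) (rule G0)
  show "pair_integral \<gamma> r \<le> kernel_mass DIM('a) \<gamma> r * sq_integral"
    using up kernel_mass_nonneg[OF \<gamma>] integrals_nonneg unfolding eq[symmetric] by (simp add: ennreal_le_iff)
  show "kernel_mass DIM('a) \<gamma> r * (sq_integral - e) \<le> pair_integral \<gamma> r"
    if e: "\<And>u. norm u \<le> r \<Longrightarrow> (LINT x|lborel. \<bar>(f (x + u))\<^sup>2 - (f x)\<^sup>2\<bar>) \<le> e"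
  \<comment> \<open>A negative lower bound is trivial and would be truncated by the passage to \<open>ennreal\<close>.\<close>
  proof (cases "sq_integral - e \<ge> 0")
    case True
    have "ennreal (kernel_mass DIM('a) \<gamma> r) * ennreal (sq_integral - e) = (\<integral>\<^sup>+u. ennreal (power_kernel \<gamma> r u) * ennreal (sq_integral - e) \<partial>(lborel :: 'a measure))"
      by (subst nn_integral_multc, measurable, subst nn_integral_power_kernel[OF r \<gamma>]) (rule refl)
    also have "\<dots> \<le> ?N"
    proof (rule nn_integral_mono)
      fix u :: 'a
      show "ennreal (power_kernel \<gamma> r u) * ennreal (sq_integral - e) \<le> ennreal (power_kernel \<gamma> r u) * ennreal (corr2 u)"
      proof (cases "norm u \<le> r")
        case True
        then have "sq_integral - e \<le> corr2 u" using e[of u] corr2_ge[of u] by simp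
        then show ?thesis by (intro mult_left_mono ennreal_leI) auto
      qed (simp add: power_kernel_def)
    qed
    finally show ?thesis
      unfolding eq[symmetric] using kernel_mass_nonneg[OF \<gamma>] True nn by (simp add: ennreal_mult'[symmetric] ennreal_le_iff)
  next
    case False
    then have "kernel_mass DIM('a) \<gamma> r * (sq_integral - e) \<le> 0" using kernel_mass_nonneg[OF \<gamma>] by (intro mult_nonneg_nonpos) auto
    then show ?thesis using nn by simp
  qed
qed

text \<open>The condition on \<open>\<gamma>\<close> makes the kernel square integrable, and \<open>f\<close> is square integrable, so the
  potential is finite at every point and not only almost everywhere.\<close>

lemma potential_integrable:
  assumes r: "r > 0" and \<gamma>: "2 * \<gamma> > - real DIM('a)"
  shows "integrable lborel (\<lambda>y. power_kernel \<gamma> r (x - y) * f y)"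
proof -
  have "integrable lborel (\<lambda>y. (power_kernel (2 * \<gamma>) r (x - y) + (f y)\<^sup>2) / 2)"
    using kernel_translate(1)[OF r \<gamma>] f_sq by simp
  then show ?thesis
  proof (rule Bochner_Integration.integrable_bound)
    show "AE y in lborel. norm (power_kernel \<gamma> r (x - y) * f y) \<le> norm ((power_kernel (2 * \<gamma>) r (x - y) + (f y)\<^sup>2) / 2)"
      using mult_le_mean_squares[of "power_kernel \<gamma> r (x - y)" "f y" for y] f_nonneg
      by (intro AE_I2) (simp add: power_kernel_square abs_of_nonneg)
  qed measurable
qed

lemma potential_nonneg: "potential \<gamma> r x \<ge> 0"
  unfolding potential_def by (intro Bochner_Integration.integral_nonneg) (simp add: f_nonneg)

lemma potential_measurable [measurable]: "potential \<gamma> r \<in> borel_measurable borel"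
  unfolding potential_def[abs_def] by measurable

lemma ennreal_potential:
  assumes r: "r > 0" and \<gamma>: "2 * \<gamma> > - real DIM('a)"
  shows "ennreal (potential \<gamma> r x) = (\<integral>\<^sup>+u. ennreal (power_kernel \<gamma> r u * f (x + u)) \<partial>lborel)"
proof -
  have "ennreal (potential \<gamma> r x) = (\<integral>\<^sup>+y. ennreal (power_kernel \<gamma> r (x - y) * f y) \<partial>lborel)"
    unfolding potential_def using nn_integral_eq_integral[OF potential_integrable[OF assms]] f_nonneg by simp
  also have "\<dots> = (\<integral>\<^sup>+u. ennreal (power_kernel \<gamma> r u * f (x + u)) \<partial>lborel)"
    by (subst lborel_nn_integral_translate[of _ x, symmetric]) (auto simp: power_kernel_minus add.commute)
  finally show ?thesis .
qed

text \<open>The square of the potential is a double integral over the differences \<open>u\<close> and \<open>v\<close>; moving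
  the integration over the common point \<open>x\<close> inside produces \<open>corr3\<close>.\<close>

lemma nn_triple_integral:
  assumes r: "r > 0" and \<gamma>: "2 * \<gamma> > - real DIM('a)"
  shows "(\<integral>\<^sup>+x. ennreal ((potential \<gamma> r x)\<^sup>2 * f x) \<partial>lborel) =
   (\<integral>\<^sup>+u. \<integral>\<^sup>+v. ennreal (power_kernel \<gamma> r u) * (ennreal (power_kernel \<gamma> r v) * ennreal (corr3 u v)) \<partial>lborel \<partial>lborel)"
proof -
  let ?k = "power_kernel \<gamma> r :: 'a \<Rightarrow> real"
  have "ennreal ((potential \<gamma> r x)\<^sup>2 * f x) =
      (\<integral>\<^sup>+u. \<integral>\<^sup>+v. ennreal (?k u * f (x + u) * (?k v * f (x + v)) * f x) \<partial>lborel \<partial>lborel)" for x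
  proof -
    let ?a = "\<lambda>u. ennreal (?k u * f (x + u))"
    have "ennreal ((potential \<gamma> r x)\<^sup>2 * f x) = (\<integral>\<^sup>+u. ?a u \<partial>lborel) * (\<integral>\<^sup>+v. ?a v \<partial>lborel) * ennreal (f x)"
      unfolding ennreal_potential[OF assms, symmetric]
      using potential_nonneg f_nonneg by (simp add: ennreal_mult' power2_eq_square)
    also have "\<dots> = (\<integral>\<^sup>+u. \<integral>\<^sup>+v. ?a u * ?a v * ennreal (f x) \<partial>lborel \<partial>lborel)"
      by (simp add: nn_integral_multc nn_integral_cmult)
    also have "\<dots> = (\<integral>\<^sup>+u. \<integral>\<^sup>+v. ennreal (?k u * f (x + u) * (?k v * f (x + v)) * f x) \<partial>lborel \<partial>lborel)"
      using f_nonneg by (simp add: ennreal_mult'[symmetric])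
    finally show ?thesis .
  qed
  then have "(\<integral>\<^sup>+x. ennreal ((potential \<gamma> r x)\<^sup>2 * f x) \<partial>lborel) =
     (\<integral>\<^sup>+x. \<integral>\<^sup>+u. \<integral>\<^sup>+v. ennreal (?k u * f (x + u) * (?k v * f (x + v)) * f x) \<partial>lborel \<partial>lborel \<partial>lborel)"
    by simp
  also have "\<dots> = (\<integral>\<^sup>+u. \<integral>\<^sup>+x. \<integral>\<^sup>+v. ennreal (?k u * f (x + u) * (?k v * f (x + v)) * f x) \<partial>lborel \<partial>lborel \<partial>lborel)"
    by (rule lborel_pair.Fubini') measurable
  also have "\<dots> = (\<integral>\<^sup>+u. \<integral>\<^sup>+v. \<integral>\<^sup>+x. ennreal (?k u * f (x + u) * (?k v * f (x + v)) * f x) \<partial>lborel \<partial>lborel \<partial>lborel)"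
    by (rule nn_integral_cong, rule lborel_pair.Fubini') measurable
  also have "\<dots> = (\<integral>\<^sup>+u. \<integral>\<^sup>+v. ennreal (?k u) * (ennreal (?k v) * ennreal (corr3 u v)) \<partial>lborel \<partial>lborel)"
  proof (intro nn_integral_cong)
    fix u v
    have "(\<integral>\<^sup>+x. ennreal (?k u * f (x + u) * (?k v * f (x + v)) * f x) \<partial>lborel) =
        (\<integral>\<^sup>+x. ennreal (?k u * ?k v) * ennreal (f x * f (x + u) * f (x + v)) \<partial>lborel)"
      by (simp add: ennreal_mult'[symmetric] mult_ac)
    also have "\<dots> = ennreal (?k u * ?k v) * (\<integral>\<^sup>+x. ennreal (f x * f (x + u) * f (x + v)) \<partial>lborel)"
      by (rule nn_integral_cmult) measurable
    also have "(\<integral>\<^sup>+x. ennreal (f x * f (x + u) * f (x + v)) \<partial>lborel) = ennreal (corr3 u v)"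
      unfolding corr3_def by (rule nn_integral_eq_integral[OF corr3_integrable]) (simp add: f_nonneg)
    finally show "(\<integral>\<^sup>+x. ennreal (?k u * f (x + u) * (?k v * f (x + v)) * f x) \<partial>lborel) =
       ennreal (?k u) * (ennreal (?k v) * ennreal (corr3 u v))"
      by (simp add: ennreal_mult' mult.assoc)
  qed
  finally show ?thesis .
qed

lemma triple_integrable_and_bounds:
  assumes r: "r > 0" and \<gamma>: "2 * \<gamma> > - real DIM('a)"
  shows triple_integrable: "integrable lborel (\<lambda>x. (potential \<gamma> r x)\<^sup>2 * f x)"
    and triple_integral_le: "triple_integral \<gamma> r \<le> (kernel_mass DIM('a) \<gamma> r)\<^sup>2 * cube_integral"
    and triple_integral_ge: "(\<And>u. norm u \<le> r \<Longrightarrow> (LINT x|lborel. \<bar>f (x + u) ^ 3 - f x ^ 3\<bar>) \<le> e) \<Longrightarrow>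
      (kernel_mass DIM('a) \<gamma> r)\<^sup>2 * (cube_integral - 2 * e) \<le> triple_integral \<gamma> r"
proof -
  have \<gamma>': "\<gamma> > - real DIM('a)" using \<gamma> by simp
  let ?G = "\<lambda>x. (potential \<gamma> r x)\<^sup>2 * f x"
  let ?N = "\<integral>\<^sup>+u. \<integral>\<^sup>+v. ennreal (power_kernel \<gamma> r u) * (ennreal (power_kernel \<gamma> r v) * ennreal (corr3 u v)) \<partial>lborel \<partial>lborel"
  have G0: "0 \<le> ?G x" for x using f_nonneg by auto
  have "?N \<le> (\<integral>\<^sup>+u. \<integral>\<^sup>+v. ennreal (power_kernel \<gamma> r u) * (ennreal (power_kernel \<gamma> r v) * ennreal cube_integral)
      \<partial>(lborel :: 'a measure) \<partial>(lborel :: 'a measure))"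
    by (intro nn_integral_mono mult_left_mono ennreal_leI corr3_le) auto
  also have "\<dots> = ennreal ((kernel_mass DIM('a) \<gamma> r)\<^sup>2 * cube_integral)" by (rule nn_double_kernel[OF r \<gamma>' integrals_nonneg(2)])
  finally have up: "?N \<le> ennreal ((kernel_mass DIM('a) \<gamma> r)\<^sup>2 * cube_integral)" .
  show I: "integrable lborel ?G"
  proof (rule integrableI_nonneg)
    show "(\<integral>\<^sup>+x. ennreal (?G x) \<partial>lborel) < \<infinity>"
      using le_less_trans[OF up ennreal_less_top] unfolding nn_triple_integral[OF assms] by simp
  qed (use G0 in auto)
  have eq: "ennreal (triple_integral \<gamma> r) = ?N"
    unfolding triple_integral_def using nn_integral_eq_integral[OF I] G0 nn_triple_integral[OF assms] by simp
  have nn: "triple_integral \<gamma> r \<ge> 0"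
    unfolding triple_integral_def by (rule Bochner_Integration.integral_nonneg) (rule G0)
  show "triple_integral \<gamma> r \<le> (kernel_mass DIM('a) \<gamma> r)\<^sup>2 * cube_integral"
    using up integrals_nonneg unfolding eq[symmetric] by (simp add: ennreal_le_iff)
  show "(kernel_mass DIM('a) \<gamma> r)\<^sup>2 * (cube_integral - 2 * e) \<le> triple_integral \<gamma> r"
    if e: "\<And>u. norm u \<le> r \<Longrightarrow> (LINT x|lborel. \<bar>f (x + u) ^ 3 - f x ^ 3\<bar>) \<le> e"
  proof (cases "cube_integral - 2 * e \<ge> 0")
    case True
    have "ennreal ((kernel_mass DIM('a) \<gamma> r)\<^sup>2 * (cube_integral - 2 * e)) =
        (\<integral>\<^sup>+u. \<integral>\<^sup>+v. ennreal (power_kernel \<gamma> r u) * (ennreal (power_kernel \<gamma> r v) * ennreal (cube_integral - 2 * e))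
          \<partial>(lborel :: 'a measure) \<partial>(lborel :: 'a measure))"
      by (rule nn_double_kernel[OF r \<gamma>' True, symmetric])
    also have "\<dots> \<le> ?N"
    proof (intro nn_integral_mono)
      fix u v :: 'a
      show "ennreal (power_kernel \<gamma> r u) * (ennreal (power_kernel \<gamma> r v) * ennreal (cube_integral - 2 * e)) \<le>
          ennreal (power_kernel \<gamma> r u) * (ennreal (power_kernel \<gamma> r v) * ennreal (corr3 u v))"
      proof (cases "norm u \<le> r \<and> norm v \<le> r")
        case True
        then have "cube_integral - 2 * e \<le> corr3 u v" using e[of u] e[of v] corr3_ge[of u v] by simp
        then show ?thesis by (intro mult_left_mono ennreal_leI) auto
      qed (auto simp: power_kernel_def)
    qed
    finally show ?thesis
      unfolding eq[symmetric] using nn by (simp add: ennreal_le_iff)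
  next
    case False
    then have "(kernel_mass DIM('a) \<gamma> r)\<^sup>2 * (cube_integral - 2 * e) \<le> 0" by (intro mult_nonneg_nonpos) auto
    then show ?thesis using nn by simp
  qed
qed

lemma pair_integral_tendsto:
  assumes \<gamma>: "\<gamma> > - real DIM('a)"
  shows "((\<lambda>r. pair_integral \<gamma> r / r powr (\<gamma> + real DIM('a))) \<longlongrightarrow> ball_moment DIM('a) \<gamma> * sq_integral) (at_right 0)"
proof (rule tendstoI)
  fix e :: real assume e: "e > 0"
  have C0: "ball_moment DIM('a) \<gamma> \<ge> 0" using \<gamma> by (simp add: ball_moment_def)
  define e' where "e' = e / (2 * (ball_moment DIM('a) \<gamma> + 1))"
  have e': "e' > 0" "ball_moment DIM('a) \<gamma> * e' < e" using e C0 by (auto simp: e'_def field_simps add_pos_nonneg)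
  obtain \<delta> where \<delta>: "\<delta> > 0" "\<And>u. norm u < \<delta> \<Longrightarrow> (LINT x|lborel. \<bar>(f (x + u))\<^sup>2 - (f x)\<^sup>2\<bar>) < e'"
    using integral_abs_translate_diff_less[OF f_sq e'(1)] by blast
  have "\<forall>\<^sub>F r in at_right 0. r < \<delta>" using \<delta>(1) by (auto simp: eventually_at_right_field)
  moreover have "\<forall>\<^sub>F r in at_right (0::real). r > 0" by (auto simp: eventually_at_right_field intro: exI[of _ 1])
  ultimately show "\<forall>\<^sub>F r in at_right 0. dist (pair_integral \<gamma> r / r powr (\<gamma> + real DIM('a))) (ball_moment DIM('a) \<gamma> * sq_integral) < e"
  proof eventually_elim
    case (elim r)
    let ?p = "r powr (\<gamma> + real DIM('a))"
    have p: "?p > 0" using elim by simp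
    have "pair_integral \<gamma> r \<le> ball_moment DIM('a) \<gamma> * sq_integral * ?p"
      using pair_integral_le[OF elim(2) \<gamma>] by (simp add: kernel_mass_def mult_ac)
    moreover have "(LINT x|lborel. \<bar>(f (x + u))\<^sup>2 - (f x)\<^sup>2\<bar>) \<le> e'" if "norm u \<le> r" for u
      using \<delta>(2)[of u] that elim(1) by simp
    then have "(ball_moment DIM('a) \<gamma> * sq_integral - ball_moment DIM('a) \<gamma> * e') * ?p \<le> pair_integral \<gamma> r"
      using pair_integral_ge[OF elim(2) \<gamma>] by (simp add: kernel_mass_def algebra_simps)
    ultimately have "pair_integral \<gamma> r / ?p \<le> ball_moment DIM('a) \<gamma> * sq_integral" "ball_moment DIM('a) \<gamma> * sq_integral - ball_moment DIM('a) \<gamma> * e' \<le> pair_integral \<gamma> r / ?p"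
      using p by (auto simp: pos_divide_le_eq pos_le_divide_eq)
    then show ?case using e'(2) by (simp add: dist_real_def)
  qed
qed

lemma triple_integral_tendsto:
  assumes \<gamma>: "2 * \<gamma> > - real DIM('a)"
  shows "((\<lambda>r. triple_integral \<gamma> r / (r powr (\<gamma> + real DIM('a)))\<^sup>2) \<longlongrightarrow> (ball_moment DIM('a) \<gamma>)\<^sup>2 * cube_integral) (at_right 0)"
proof (rule tendstoI)
  fix e :: real assume e: "e > 0"
  define e' where "e' = e / (4 * ((ball_moment DIM('a) \<gamma>)\<^sup>2 + 1))"
  have e': "e' > 0" "(ball_moment DIM('a) \<gamma>)\<^sup>2 * (2 * e') < e" using e by (auto simp: e'_def field_simps add_pos_nonneg)
  obtain \<delta> where \<delta>: "\<delta> > 0" "\<And>u. norm u < \<delta> \<Longrightarrow> (LINT x|lborel. \<bar>f (x + u) ^ 3 - f x ^ 3\<bar>) < e'"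
    using integral_abs_translate_diff_less[OF f_cube e'(1)] by blast
  have "\<forall>\<^sub>F r in at_right 0. r < \<delta>" using \<delta>(1) by (auto simp: eventually_at_right_field)
  moreover have "\<forall>\<^sub>F r in at_right (0::real). r > 0" by (auto simp: eventually_at_right_field intro: exI[of _ 1])
  ultimately show "\<forall>\<^sub>F r in at_right 0. dist (triple_integral \<gamma> r / (r powr (\<gamma> + real DIM('a)))\<^sup>2) ((ball_moment DIM('a) \<gamma>)\<^sup>2 * cube_integral) < e"
  proof eventually_elim
    case (elim r)
    let ?p = "(r powr (\<gamma> + real DIM('a)))\<^sup>2"
    have p: "?p > 0" using elim by simp
    have "triple_integral \<gamma> r \<le> (ball_moment DIM('a) \<gamma>)\<^sup>2 * cube_integral * ?p"
      using triple_integral_le[OF elim(2) \<gamma>] by (simp add: kernel_mass_def mult_ac power_mult_distrib)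
    moreover have "(LINT x|lborel. \<bar>f (x + u) ^ 3 - f x ^ 3\<bar>) \<le> e'" if "norm u \<le> r" for u
      using \<delta>(2)[of u] that elim(1) by simp
    then have "((ball_moment DIM('a) \<gamma>)\<^sup>2 * cube_integral - (ball_moment DIM('a) \<gamma>)\<^sup>2 * (2 * e')) * ?p \<le> triple_integral \<gamma> r"
      using triple_integral_ge[OF elim(2) \<gamma>] by (simp add: kernel_mass_def algebra_simps power_mult_distrib)
    ultimately have "triple_integral \<gamma> r / ?p \<le> (ball_moment DIM('a) \<gamma>)\<^sup>2 * cube_integral" "(ball_moment DIM('a) \<gamma>)\<^sup>2 * cube_integral - (ball_moment DIM('a) \<gamma>)\<^sup>2 * (2 * e') \<le> triple_integral \<gamma> r / ?p"
      using p by (auto simp: pos_divide_le_eq pos_le_divide_eq)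
    then show ?case using e'(2) by (simp add: dist_real_def)
  qed
qed

end

section \<open>The length power functional as a pair statistic\<close>

text \<open>The diagonal may be included: by the convention \<open>0 powr \<beta> = 0\<close> the kernel vanishes at the origin
  for every exponent.\<close>

lemma length_power_eq_double_sum:
  assumes "finite P"
  shows "length_power \<beta> r P = (\<Sum>x\<in>P. \<Sum>y\<in>P. power_kernel \<beta> r (x - y)) / 2"
proof -
  have "(\<Sum>(x, y)\<in>{(x, y). x \<in> P \<and> y \<in> P \<and> x \<noteq> y}. of_bool (norm (x - y) \<le> r) * norm (x - y) powr \<beta>) =
      (\<Sum>(x, y)\<in>P \<times> P. power_kernel \<beta> r (x - y))"
    using assms by (intro sum.mono_neutral_cong_left) (auto simp: power_kernel_def)
  then show ?thesis by (simp add: length_power_def sum.cartesian_product)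
qed

text \<open>The functional is a function of the set of sample points, so coinciding points are counted once.
  Summing over the first occurrences of each point expresses it through the variables themselves,
  which yields measurability everywhere and not only off the null set of coincidences.\<close>

definition first_indices :: "(nat \<Rightarrow> 'b) \<Rightarrow> nat \<Rightarrow> nat set" where
  "first_indices x n = {i \<in> {1..n}. \<forall>k\<in>{1..<i}. x k \<noteq> x i}"

lemma bij_betw_first_indices: "bij_betw x (first_indices x n) (x ` {1..n})"
proof (rule bij_betw_imageI)
  show "inj_on x (first_indices x n)"
  proof (rule linorder_inj_onI)
    fix i j assume "i < j" "i \<in> first_indices x n" "j \<in> first_indices x n"
    then show "x i \<noteq> x j" by (auto simp: first_indices_def)
  qed auto
  show "x ` first_indices x n = x ` {1..n}"
  proof
    show "x ` {1..n} \<subseteq> x ` first_indices x n"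
    proof
      fix y assume "y \<in> x ` {1..n}"
      then obtain i where i: "i \<in> {1..n}" "y = x i" by auto
      define m where "m = (LEAST k. k \<in> {1..n} \<and> x k = y)"
      have m: "m \<in> {1..n}" "x m = y"
        using LeastI[of "\<lambda>k. k \<in> {1..n} \<and> x k = y" i] i by (auto simp: m_def)
      have "x k \<noteq> y" if "k \<in> {1..<m}" for k
        using not_less_Least[of k "\<lambda>k. k \<in> {1..n} \<and> x k = y", folded m_def] that m by auto
      then show "y \<in> x ` first_indices x n" using m by (auto simp: first_indices_def)
    qed
  qed (auto simp: first_indices_def)
qed

lemma length_power_point_sample:
  "length_power \<beta> r (point_sample X n \<omega>) =
    (\<Sum>i=1..n. \<Sum>j=1..n. of_bool (i \<in> first_indices (\<lambda>i. X i \<omega>) n) * (of_bool (j \<in> first_indices (\<lambda>i. X i \<omega>) n) *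
      power_kernel \<beta> r (X i \<omega> - X j \<omega>))) / 2"
proof -
  let ?J = "first_indices (\<lambda>i. X i \<omega>) n"
  have b: "bij_betw (\<lambda>i. X i \<omega>) ?J (point_sample X n \<omega>)"
    unfolding point_sample_def by (rule bij_betw_first_indices)
  have J: "{1..n} \<inter> ?J = ?J" by (auto simp: first_indices_def)
  have finite_I: "finite (point_sample X n \<omega>)" by (simp add: point_sample_def)
  have e: "(\<Sum>i=1..n. of_bool (i \<in> ?J) * F i) = (\<Sum>i\<in>?J. F i)" for F :: "nat \<Rightarrow> real"
  proof -
    have "(\<Sum>i=1..n. of_bool (i \<in> ?J) * F i) = (\<Sum>i=1..n. if i \<in> ?J then F i else 0)"
      by (intro sum.cong) auto
    also have "\<dots> = (\<Sum>i\<in>{1..n} \<inter> ?J. F i)" by (rule sum.inter_restrict[symmetric]) simp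
    finally show ?thesis unfolding J .
  qed
  have "(\<Sum>x\<in>point_sample X n \<omega>. \<Sum>y\<in>point_sample X n \<omega>. power_kernel \<beta> r (x - y)) =
      (\<Sum>i\<in>?J. \<Sum>j\<in>?J. power_kernel \<beta> r (X i \<omega> - X j \<omega>))"
    by (simp add: sum.reindex_bij_betw[OF b, symmetric])
  then show ?thesis
    unfolding length_power_eq_double_sum[OF finite_I] sum_distrib_left[symmetric] e by simp
qed

lemma length_power_point_sample_measurable:
  fixes X :: "nat \<Rightarrow> 'w \<Rightarrow> 'a::euclidean_space"
  assumes X: "\<And>i. i \<ge> 1 \<Longrightarrow> X i \<in> borel_measurable M"
  shows "(\<lambda>\<omega>. length_power \<beta> r (point_sample X n \<omega>)) \<in> borel_measurable M"
proof -
  have P: "Measurable.pred M (\<lambda>\<omega>. i \<in> first_indices (\<lambda>i. X i \<omega>) n)" for i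
  proof -
    have "Measurable.pred M (\<lambda>\<omega>. X k \<omega> \<noteq> X i \<omega>)" if "k \<ge> 1" "i \<ge> 1" for k
    proof -
      note [measurable] = X[OF that(1)] X[OF that(2)]
      show ?thesis by measurable
    qed
    then have "i \<in> {1..n} \<Longrightarrow> Measurable.pred M (\<lambda>\<omega>. \<forall>k\<in>{1..<i}. X k \<omega> \<noteq> X i \<omega>)"
      by (intro pred_intros_finite) auto
    then show ?thesis by (cases "i \<in> {1..n}") (auto simp: first_indices_def)
  qed
  have "(\<lambda>\<omega>. power_kernel \<beta> r (X i \<omega> - X j \<omega>)) \<in> borel_measurable M" if "i \<in> {1..n}" "j \<in> {1..n}" for i j
  proof -
    have [measurable]: "X i \<in> borel_measurable M" "X j \<in> borel_measurable M" using X that by auto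
    show ?thesis by measurable
  qed
  moreover have "(\<lambda>\<omega>. of_bool (i \<in> first_indices (\<lambda>i. X i \<omega>) n) :: real) \<in> borel_measurable M" for i
    using P[of i] by measurable
  ultimately show ?thesis
    unfolding length_power_point_sample
    by (intro borel_measurable_divide borel_measurable_const borel_measurable_sum borel_measurable_times)
qed

lemma length_power_point_sample_inj:
  assumes "inj_on (\<lambda>i. X i \<omega>) {1..n}"
  shows "length_power \<beta> r (point_sample X n \<omega>) =
    (\<Sum>p\<in>{p \<in> {1..n} \<times> {1..n}. fst p \<noteq> snd p}. power_kernel \<beta> r (X (fst p) \<omega> - X (snd p) \<omega>)) / 2"
proof -
  have "length_power \<beta> r (point_sample X n \<omega>) = (\<Sum>p\<in>{1..n} \<times> {1..n}. power_kernel \<beta> r (X (fst p) \<omega> - X (snd p) \<omega>)) / 2"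
  proof -
    have "length_power \<beta> r (point_sample X n \<omega>) = (\<Sum>i=1..n. \<Sum>j=1..n. power_kernel \<beta> r (X i \<omega> - X j \<omega>)) / 2"
      by (subst length_power_eq_double_sum) (simp_all only: point_sample_def sum.reindex[OF assms] o_def finite_imageI finite_atLeastAtMost)
    then show ?thesis by (simp add: sum.cartesian_product case_prod_beta')
  qed
  also have "(\<Sum>p\<in>{1..n} \<times> {1..n}. power_kernel \<beta> r (X (fst p) \<omega> - X (snd p) \<omega>)) =
     (\<Sum>p\<in>{p \<in> {1..n} \<times> {1..n}. fst p \<noteq> snd p}. power_kernel \<beta> r (X (fst p) \<omega> - X (snd p) \<omega>))"
    by (intro sum.mono_neutral_right) (auto simp: power_kernel_def)
  finally show ?thesis .
qed

text \<open>For an atomless law the diagonal is a null set of the product by Fubini's theorem.\<close>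

lemma (in iid_pair_kernel) AE_inj_on:
  assumes diag: "{(x, y). x = y} \<inter> space (N \<Otimes>\<^sub>M N) \<in> sets (N \<Otimes>\<^sub>M N)"
    and atomless: "\<And>x. AE y in D. x \<noteq> y"
  shows "AE \<omega> in M. inj_on (\<lambda>i. X i \<omega>) I"
proof -
  have "AE \<omega> in M. X (fst p) \<omega> \<noteq> X (snd p) \<omega>" if p: "p \<in> index_pairs" for p
  proof -
    obtain i j where e: "p = (i, j)" "i \<in> I" "j \<in> I" "i \<noteq> j" using p by (rule index_pairsE)
    interpret D: prob_space D using D_prob e by auto
    interpret DD: pair_prob_space D D ..
    have s: "sets (D \<Otimes>\<^sub>M D) = sets (N \<Otimes>\<^sub>M N)" by (intro sets_pair_measure_cong D_sets[OF e(2)])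
    have sp: "space (D \<Otimes>\<^sub>M D) = space (N \<Otimes>\<^sub>M N)" by (rule sets_eq_imp_space_eq[OF s])
    have set: "{z \<in> space (N \<Otimes>\<^sub>M N). fst z \<noteq> snd z} \<in> sets (N \<Otimes>\<^sub>M N)"
    proof -
      have "{z \<in> space (N \<Otimes>\<^sub>M N). fst z \<noteq> snd z} = space (N \<Otimes>\<^sub>M N) - ({(x, y). x = y} \<inter> space (N \<Otimes>\<^sub>M N))"
        by auto
      then show ?thesis using diag by auto
    qed
    have "AE z in D \<Otimes>\<^sub>M D. fst z \<noteq> snd z"
      by (rule DD.AE_pair_measure) (use set atomless in \<open>auto simp: s sp\<close>)
    then have "AE z in distr M (N \<Otimes>\<^sub>M N) (\<lambda>\<omega>. (X i \<omega>, X j \<omega>)). fst z \<noteq> snd z"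
      unfolding distr_pair[OF e(2-4)] .
    then show ?thesis
      using e by (subst (asm) AE_distr_iff) (auto intro!: measurable_Pair rv set)
  qed
  then have "AE \<omega> in M. \<forall>p\<in>index_pairs. X (fst p) \<omega> \<noteq> X (snd p) \<omega>"
    using finite_index_pairs by (simp add: AE_finite_all)
  then show ?thesis
  proof eventually_elim
    case (elim \<omega>)
    show ?case
    proof (rule inj_onI, rule ccontr)
      fix i j assume "i \<in> I" "j \<in> I" "X i \<omega> = X j \<omega>" "i \<noteq> j"
      with bspec[OF elim, of "(i, j)"] show False by (simp add: index_pairs_iff)
    qed
  qed
qed

section \<open>The exact variance\<close>

locale L3_density = square_cube_integrable f for f :: "'a::euclidean_space \<Rightarrow> real" +
  assumes f_prob: "(\<integral>\<^sup>+x. ennreal (f x) \<partial>lborel) = 1"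
begin

abbreviation D :: "'a measure" where "D \<equiv> density lborel (\<lambda>x. ennreal (f x))"

lemma f_integrable: "integrable lborel f"
  by (rule integrableI_nonneg) (use f_prob f_nonneg in auto)

lemma f_integral: "(LINT x|lborel. f x) = 1"
  using nn_integral_eq_integral[OF f_integrable] f_nonneg f_prob
  by (simp add: ennreal_eq_1)

lemma prob_space_D: "prob_space D"
  by (rule prob_spaceI) (simp add: emeasure_density f_prob)

lemma D_pair: "D \<Otimes>\<^sub>M D = density (lborel \<Otimes>\<^sub>M lborel) (\<lambda>(x, y). ennreal (f x) * ennreal (f y))"
proof -
  interpret D: prob_space D by (rule prob_space_D)
  show ?thesis
    by (rule pair_measure_density) (auto simp: sigma_finite_lborel D.sigma_finite_measure_axioms)
qed

lemma D_pair_kernel: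
  assumes r: "r > 0" and \<gamma>: "\<gamma> > - real DIM('a)"
  shows "integrable (D \<Otimes>\<^sub>M D) (\<lambda>(x, y). power_kernel \<gamma> r (x - y))"
    and "(\<integral>z. (case z of (x, y) \<Rightarrow> power_kernel \<gamma> r (x - y)) \<partial>(D \<Otimes>\<^sub>M D)) = pair_integral \<gamma> r"
proof -
  have e: "(\<lambda>(x, y). ennreal (f x) * ennreal (f y)) = (\<lambda>z. ennreal (f (fst z) * f (snd z)))"
    using f_nonneg by (auto simp: ennreal_mult')
  show "integrable (D \<Otimes>\<^sub>M D) (\<lambda>(x, y). power_kernel \<gamma> r (x - y))"
    unfolding D_pair e
    by (subst integrable_density)
       (use pair_integrable[OF r \<gamma>] f_nonneg in \<open>auto simp: case_prod_beta' mult_ac\<close>)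
  show "(\<integral>z. (case z of (x, y) \<Rightarrow> power_kernel \<gamma> r (x - y)) \<partial>(D \<Otimes>\<^sub>M D)) = pair_integral \<gamma> r"
    unfolding D_pair e pair_integral_def
    by (subst integral_density) (use f_nonneg in \<open>auto simp: case_prod_beta' mult_ac\<close>)
qed

lemma D_atomless: "AE y in D. x \<noteq> y"
  using AE_lborel_singleton[of x] by (subst AE_density) (auto elim: eventually_mono)

text \<open>The functional agrees almost surely with half of the pair sum, which accounts for the factor 1/4
  between the variances.\<close>

lemma variance_length_power:
  fixes M :: "'w measure" and X :: "nat \<Rightarrow> 'w \<Rightarrow> 'a"
  assumes M: "prob_space M"
    and indep: "prob_space.indep_vars M (\<lambda>_. borel) X {1..}"
    and X_distr: "\<And>i. i \<ge> 1 \<Longrightarrow> distr M borel (X i) = D"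
    and r: "r > 0" and \<beta>: "\<beta> > - real DIM('a) / 2"
  shows "integrable M (\<lambda>\<omega>. (length_power \<beta> r (point_sample X n \<omega>))\<^sup>2)"
    and "prob_space.variance M (\<lambda>\<omega>. length_power \<beta> r (point_sample X n \<omega>)) =
      real n * (real n - 1) / 2 * pair_integral (2 * \<beta>) r
      + real n * (real n - 1) * (real n - 2) * triple_integral \<beta> r
      - real n * (real n - 1) * (real n - 3 / 2) * (pair_integral \<beta> r)\<^sup>2"
proof -
  interpret M: prob_space M by (rule M)
  interpret D: prob_space D by (rule prob_space_D)
  let ?h = "\<lambda>x y :: 'a. power_kernel \<beta> r (x - y)"
  have \<beta>': "2 * \<beta> > - real DIM('a)" "\<beta> > - real DIM('a)" using \<beta> by auto
  interpret U: iid_pair_kernel M X borel D "{1..n}" ?h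
  proof
    show "M.indep_vars (\<lambda>_. borel) X {1..n}"
      using indep by (rule M.indep_vars_subset) auto
    show "integrable (D \<Otimes>\<^sub>M D) (\<lambda>(x, y). (?h x y)\<^sup>2)"
      using D_pair_kernel(1)[OF r \<beta>'(1)] by (simp add: power_kernel_square)
    show "(\<lambda>(x, y). ?h x y) \<in> borel_measurable (borel \<Otimes>\<^sub>M borel)" by measurable
  qed (auto simp: X_distr power_kernel_commute)
  have kernel_mean: "U.kernel_mean = pair_integral \<beta> r"
    unfolding U.kernel_mean_def by (rule D_pair_kernel(2)[OF r \<beta>'(2)])
  have second_moment: "U.second_moment = pair_integral (2 * \<beta>) r"
    unfolding U.second_moment_def power_kernel_square by (rule D_pair_kernel(2)[OF r \<beta>'(1)])
  have inner: "(\<integral>y. ?h x y \<partial>D) = potential \<beta> r x" for x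
    unfolding potential_def by (subst integral_density) (auto simp: f_nonneg mult.commute)
  have projection_moment: "U.projection_moment = triple_integral \<beta> r"
    unfolding U.projection_moment_def inner triple_integral_def
    by (subst integral_density) (auto simp: f_nonneg mult.commute)
  let ?T = "\<lambda>\<omega>. \<Sum>p\<in>U.index_pairs. U.pair_value p \<omega>" and ?L = "\<lambda>\<omega>. length_power \<beta> r (point_sample X n \<omega>)"
  have "AE \<omega> in M. inj_on (\<lambda>i. X i \<omega>) {1..n}"
  proof (rule U.AE_inj_on)
    have "closed {(x, y). x = (y :: 'a)}"
      using closed_Collect_eq[of fst "snd :: 'a \<times> 'a \<Rightarrow> 'a"]
      by (simp add: case_prod_beta' continuous_on_fst continuous_on_snd)
    then show "{(x, y). x = y} \<inter> space (borel \<Otimes>\<^sub>M borel) \<in> sets (borel \<Otimes>\<^sub>M (borel :: 'a measure))"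
      unfolding borel_prod by (simp add: borel_closed)
  qed (rule D_atomless)
  then have AE: "AE \<omega> in M. ?L \<omega> = ?T \<omega> / 2"
    by eventually_elim (unfold U.index_pairs_def U.pair_value_def, rule length_power_point_sample_inj)
  have L_meas [measurable]: "?L \<in> borel_measurable M"
  proof (rule length_power_point_sample_measurable)
    fix i :: nat assume "i \<ge> 1"
    then show "X i \<in> borel_measurable M" using indep by (auto simp: M.indep_vars_def)
  qed
  have T_meas [measurable]: "?T \<in> borel_measurable M"
    by (intro borel_measurable_sum U.pair_value_meas)
  have AE_sq: "AE \<omega> in M. (?L \<omega>)\<^sup>2 = (?T \<omega> / 2)\<^sup>2"
    using AE by eventually_elim (simp only:)
  have "integrable M (\<lambda>\<omega>. (?T \<omega> / 2)\<^sup>2)"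
    using U.pair_sum_sq_integrable by (simp add: power_divide)
  moreover have "integrable M (\<lambda>\<omega>. (?L \<omega>)\<^sup>2) = integrable M (\<lambda>\<omega>. (?T \<omega> / 2)\<^sup>2)"
    by (rule integrable_cong_AE[OF _ _ AE_sq]) measurable
  ultimately show "integrable M (\<lambda>\<omega>. (?L \<omega>)\<^sup>2)" by simp
  have "M.expectation ?L = (\<integral>\<omega>. ?T \<omega> / 2 \<partial>M)"
    by (rule integral_cong_AE[OF _ _ AE]) measurable
  then have E: "M.expectation ?L = M.expectation ?T / 2" by simp
  have "AE \<omega> in M. (?L \<omega> - M.expectation ?T / 2)\<^sup>2 = (?T \<omega> - M.expectation ?T)\<^sup>2 / 4"
    using AE
  proof eventually_elim
    case (elim \<omega>)
    show ?case unfolding elim by (simp only: diff_divide_distrib[symmetric] power_divide) simp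
  qed
  then have "M.variance ?L = M.expectation (\<lambda>\<omega>. (?T \<omega> - M.expectation ?T)\<^sup>2 / 4)"
    unfolding E by (intro integral_cong_AE) measurable
  also have "\<dots> = M.variance ?T / 4" by simp
  also have "\<dots> = real n * (real n - 1) / 2 * pair_integral (2 * \<beta>) r
      + real n * (real n - 1) * (real n - 2) * triple_integral \<beta> r
      - real n * (real n - 1) * (real n - 3 / 2) * (pair_integral \<beta> r)\<^sup>2"
    unfolding U.variance_pair_sum kernel_mean projection_moment second_moment by (simp add: field_simps)
  finally show "M.variance ?L = \<dots>" .
qed

lemma pair_integral_eq_potential:
  assumes r: "r > 0" and \<gamma>: "\<gamma> > - real DIM('a)"
  shows "integrable lborel (\<lambda>x. potential \<gamma> r x * f x)"
    and "pair_integral \<gamma> r = (LINT x|lborel. potential \<gamma> r x * f x)"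
proof -
  have e: "(LINT y|lborel. power_kernel \<gamma> r (x - y) * f x * f y) = potential \<gamma> r x * f x" for x
    unfolding potential_def by (subst integral_mult_left_zero[symmetric]) (simp add: mult_ac)
  show "integrable lborel (\<lambda>x. potential \<gamma> r x * f x)"
    using lborel_pair.integrable_fst'[OF pair_integrable[OF r \<gamma>]] by (simp add: e)
  show "pair_integral \<gamma> r = (LINT x|lborel. potential \<gamma> r x * f x)"
    unfolding pair_integral_def
    using lborel_pair.integral_fst'[OF pair_integrable[OF r \<gamma>]] by (simp add: e)
qed

text \<open>For \<open>X\<close> with density \<open>f\<close>, this is the second moment of the potential at \<open>X\<close> about
  \<open>c\<close>. It is used for two centres: the mean of the potential and its upper bound.\<close>

lemma potential_centered_second_moment:
  assumes r: "r > 0" and \<gamma>: "2 * \<gamma> > - real DIM('a)"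
  shows "integrable lborel (\<lambda>x. (potential \<gamma> r x - c)\<^sup>2 * f x)"
    and "(LINT x|lborel. (potential \<gamma> r x - c)\<^sup>2 * f x) =
      triple_integral \<gamma> r - 2 * c * pair_integral \<gamma> r + c\<^sup>2"
proof -
  have \<gamma>': "\<gamma> > - real DIM('a)" using \<gamma> by simp
  note I = triple_integrable[OF r \<gamma>] pair_integral_eq_potential(1)[OF r \<gamma>'] f_integrable
  have e: "(potential \<gamma> r x - c)\<^sup>2 * f x =
     (potential \<gamma> r x)\<^sup>2 * f x - 2 * c * (potential \<gamma> r x * f x) + c\<^sup>2 * f x" for x
    by (simp add: power2_eq_square algebra_simps)
  show "integrable lborel (\<lambda>x. (potential \<gamma> r x - c)\<^sup>2 * f x)"
    unfolding e using I by simp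
  show "(LINT x|lborel. (potential \<gamma> r x - c)\<^sup>2 * f x) =
      triple_integral \<gamma> r - 2 * c * pair_integral \<gamma> r + c\<^sup>2"
    unfolding e using I by (simp add: pair_integral_eq_potential(2)[OF r \<gamma>'] triple_integral_def f_integral)
qed

lemma sq_integral_pos: "sq_integral > 0"
proof (rule ccontr)
  assume "\<not> sq_integral > 0"
  then have "sq_integral = 0" using integrals_nonneg by simp
  then have "AE x in lborel. (f x)\<^sup>2 = 0"
    unfolding sq_integral_def by (subst (asm) integral_nonneg_eq_0_iff_AE[OF f_sq]) auto
  then have "(LINT x|lborel. f x) = 0"
    by (subst integral_cong_AE[where g="\<lambda>_. 0"]) auto
  then show False by (simp add: f_integral)
qed

text \<open>The difference of the two sides is the variance of \<open>f(X)\<close> for \<open>X\<close> with density \<open>f\<close>.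
  If it vanishes, \<open>f\<close> equals its mean \<open>\<integral> f\<^sup>2\<close> wherever it is nonzero.\<close>

lemma cube_integral_ge: "sq_integral\<^sup>2 \<le> cube_integral"
  and cube_integral_eq_imp: "cube_integral = sq_integral\<^sup>2 \<Longrightarrow> AE x in lborel. f x = 0 \<or> f x = sq_integral"
proof -
  have e: "(f x - sq_integral)\<^sup>2 * f x = f x ^ 3 - 2 * sq_integral * (f x)\<^sup>2 + sq_integral\<^sup>2 * f x" for x
    by (simp add: power2_eq_square power3_eq_cube algebra_simps)
  have i: "integrable lborel (\<lambda>x. (f x - sq_integral)\<^sup>2 * f x)"
    unfolding e using f_cube f_sq f_integrable by simp
  have "(LINT x|lborel. (f x - sq_integral)\<^sup>2 * f x) = cube_integral - 2 * sq_integral * sq_integral + sq_integral\<^sup>2"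
    unfolding e using f_cube f_sq f_integrable
    by (simp add: cube_integral_def[symmetric] sq_integral_def[symmetric] f_integral)
  then have v: "(LINT x|lborel. (f x - sq_integral)\<^sup>2 * f x) = cube_integral - sq_integral\<^sup>2"
    by (simp add: power2_eq_square)
  have "0 \<le> (LINT x|lborel. (f x - sq_integral)\<^sup>2 * f x)"
    by (intro Bochner_Integration.integral_nonneg) (simp add: f_nonneg)
  then show "sq_integral\<^sup>2 \<le> cube_integral" using v by simp
  assume "cube_integral = sq_integral\<^sup>2"
  then have "AE x in lborel. (f x - sq_integral)\<^sup>2 * f x = 0"
    using v by (intro integral_nonneg_eq_0_iff_AE[OF i, THEN iffD1]) (auto simp: f_nonneg)
  then show "AE x in lborel. f x = 0 \<or> f x = sq_integral" by eventually_elim auto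
qed

end

section \<open>Asymptotics for a non-uniform density\<close>

text \<open>Each deviation of a coefficient is divided by a denominator that is at least its own positive term,
  so the quotient tends to 1 whichever of \<open>A\<close> and \<open>B\<close> dominates.\<close>

lemma quotient_of_combinations_tendsto_1:
  fixes a b A B :: "nat \<Rightarrow> real"
  assumes a: "a \<longlonglongrightarrow> s" and b: "b \<longlonglongrightarrow> t" and st: "s > 0" "t > 0"
    and AB: "\<And>n. n \<ge> 1 \<Longrightarrow> A n > 0" "\<And>n. n \<ge> 1 \<Longrightarrow> B n > 0"
    and V: "\<And>n. n \<ge> 1 \<Longrightarrow> V n = a n * A n + b n * B n"
  shows "(\<lambda>n. V n / (s * A n + t * B n)) \<longlonglongrightarrow> 1"
proof (rule LIM_zero_cancel, rule Lim_null_comparison)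
  have "(\<lambda>n. \<bar>a n - s\<bar> / s + \<bar>b n - t\<bar> / t) \<longlonglongrightarrow> \<bar>s - s\<bar> / s + \<bar>t - t\<bar> / t"
    by (intro tendsto_intros a b) (use st in auto)
  then show "(\<lambda>n. \<bar>a n - s\<bar> / s + \<bar>b n - t\<bar> / t) \<longlonglongrightarrow> 0" by simp
  show "\<forall>\<^sub>F n in sequentially. norm (V n / (s * A n + t * B n) - 1) \<le> \<bar>a n - s\<bar> / s + \<bar>b n - t\<bar> / t"
    using eventually_ge_at_top[of 1]
  proof eventually_elim
    case (elim n)
    let ?S = "s * A n + t * B n"
    have pos: "s * A n > 0" "t * B n > 0" using st AB[OF elim] by auto
    have "V n / ?S - 1 = (V n - ?S) / ?S" using pos by (simp add: diff_divide_distrib)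
    also have "V n - ?S = (a n - s) * A n + (b n - t) * B n"
      unfolding V[OF elim] by (simp add: algebra_simps)
    also have "\<dots> / ?S = (a n - s) * A n / ?S + (b n - t) * B n / ?S"
      by (rule add_divide_distrib)
    also have "norm \<dots> \<le> \<bar>a n - s\<bar> * A n / ?S + \<bar>b n - t\<bar> * B n / ?S"
      using pos AB[OF elim]
      by (intro order_trans[OF norm_triangle_ineq]) (simp add: abs_mult)
    also have "\<dots> \<le> \<bar>a n - s\<bar> * A n / (s * A n) + \<bar>b n - t\<bar> * B n / (t * B n)"
      using pos AB[OF elim] by (intro add_mono divide_left_mono mult_nonneg_nonneg) (auto intro!: mult_pos_pos add_pos_pos)
    also have "\<dots> = \<bar>a n - s\<bar> / s + \<bar>b n - t\<bar> / t" using AB[OF elim] by simp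
    finally show ?case .
  qed
qed

context L3_density
begin

definition variance_formula :: "real \<Rightarrow> real \<Rightarrow> nat \<Rightarrow> real" where
  "variance_formula \<beta> r n = real n * (real n - 1) / 2 * pair_integral (2 * \<beta>) r
      + real n * (real n - 1) * (real n - 2) * triple_integral \<beta> r
      - real n * (real n - 1) * (real n - 3 / 2) * (pair_integral \<beta> r)\<^sup>2"

text \<open>The two coefficients of the variance with respect to \<open>n\<^sup>2 r\<^sup>2\<^sup>\<beta>\<^sup>+\<^sup>d\<close> and
  \<open>n\<^sup>3 r\<^sup>2\<^sup>\<beta>\<^sup>+\<^sup>2\<^sup>d\<close>. They are normalised so as to converge.\<close>

definition pair_coefficient :: "real \<Rightarrow> real \<Rightarrow> nat \<Rightarrow> real" where
  "pair_coefficient \<beta> r n = (real n - 1) / (2 * real n) * (pair_integral (2 * \<beta>) r / r powr (2 * \<beta> + real DIM('a)))"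

definition triple_coefficient :: "real \<Rightarrow> real \<Rightarrow> nat \<Rightarrow> real" where
  "triple_coefficient \<beta> r n = (real n - 1) * (real n - 2) / (real n)\<^sup>2 * (triple_integral \<beta> r / (r powr (\<beta> + real DIM('a)))\<^sup>2)
     - (real n - 1) * (real n - 3 / 2) / (real n)\<^sup>2 * (pair_integral \<beta> r / r powr (\<beta> + real DIM('a)))\<^sup>2"

lemma variance_formula_eq:
  assumes r: "r > 0" and n: "n \<ge> 1"
  shows "variance_formula \<beta> r n = pair_coefficient \<beta> r n * (real n ^ 2 * r powr (2 * \<beta> + real DIM('a)))
    + triple_coefficient \<beta> r n * (real n ^ 3 * r powr (2 * \<beta> + 2 * real DIM('a)))"
proof -
  have e: "r powr (2 * \<beta> + 2 * real DIM('a)) = (r powr (\<beta> + real DIM('a)))\<^sup>2"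
    by (simp add: power2_eq_square powr_add[symmetric])
  define p q where "p = r powr (2 * \<beta> + real DIM('a))" and "q = r powr (\<beta> + real DIM('a))"
  have pq: "p > 0" "q > 0" using r by (auto simp: p_def q_def)
  show ?thesis
    unfolding variance_formula_def pair_coefficient_def triple_coefficient_def e p_def[symmetric] q_def[symmetric]
    using pq n by (simp add: field_simps power2_eq_square power3_eq_cube)
qed

lemma coefficient_tendsto:
  fixes r :: "nat \<Rightarrow> real"
  assumes \<beta>: "\<beta> > - real DIM('a) / 2" and r: "\<And>n. r n > 0" "r \<longlonglongrightarrow> 0"
  shows "(\<lambda>n. pair_coefficient \<beta> (r n) n) \<longlonglongrightarrow> ball_moment DIM('a) (2 * \<beta>) / 2 * sq_integral"
    and "(\<lambda>n. triple_coefficient \<beta> (r n) n) \<longlonglongrightarrow> (ball_moment DIM('a) \<beta>)\<^sup>2 * (cube_integral - sq_integral\<^sup>2)"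
    and "(\<lambda>n. pair_integral \<beta> (r n) / r n powr (\<beta> + real DIM('a))) \<longlonglongrightarrow> ball_moment DIM('a) \<beta> * sq_integral"
proof -
  have \<beta>': "2 * \<beta> > - real DIM('a)" "\<beta> > - real DIM('a)" using \<beta> by auto
  have fr: "filterlim r (at_right 0) sequentially"
    by (rule tendsto_imp_filterlim_at_right[OF r(2)]) (simp add: r(1))
  note P2 = filterlim_compose[OF pair_integral_tendsto[OF \<beta>'(1)] fr]
  note P1 = filterlim_compose[OF pair_integral_tendsto[OF \<beta>'(2)] fr]
  note T = filterlim_compose[OF triple_integral_tendsto[OF \<beta>'(1)] fr]
  show "(\<lambda>n. pair_integral \<beta> (r n) / r n powr (\<beta> + real DIM('a))) \<longlonglongrightarrow> ball_moment DIM('a) \<beta> * sq_integral"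
    by (rule P1)
  have l: "(\<lambda>n. (real n - 1) / (2 * real n)) \<longlonglongrightarrow> 1 / 2"
    "(\<lambda>n. (real n - 1) * (real n - 2) / (real n)\<^sup>2) \<longlonglongrightarrow> 1"
    "(\<lambda>n. (real n - 1) * (real n - 3 / 2) / (real n)\<^sup>2) \<longlonglongrightarrow> 1"
    by real_asymp+
  show "(\<lambda>n. pair_coefficient \<beta> (r n) n) \<longlonglongrightarrow> ball_moment DIM('a) (2 * \<beta>) / 2 * sq_integral"
    unfolding pair_coefficient_def using tendsto_mult[OF l(1) P2] by simp
  have "(\<lambda>n. triple_coefficient \<beta> (r n) n) \<longlonglongrightarrow> 1 * ((ball_moment DIM('a) \<beta>)\<^sup>2 * cube_integral) - 1 * (ball_moment DIM('a) \<beta> * sq_integral)\<^sup>2"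
    unfolding triple_coefficient_def by (intro tendsto_diff tendsto_mult tendsto_power l P1 T)
  then show "(\<lambda>n. triple_coefficient \<beta> (r n) n) \<longlonglongrightarrow> (ball_moment DIM('a) \<beta>)\<^sup>2 * (cube_integral - sq_integral\<^sup>2)"
    by (simp add: algebra_simps power_mult_distrib)
qed

lemma variance_formula_asymp_nonuniform:
  fixes r :: "nat \<Rightarrow> real"
  assumes \<beta>: "\<beta> > - real DIM('a) / 2" and r: "\<And>n. r n > 0" "r \<longlonglongrightarrow> 0" and F: "cube_integral \<noteq> sq_integral\<^sup>2"
    and V: "\<And>n. n \<ge> 1 \<Longrightarrow> V n = variance_formula \<beta> (r n) n"
  shows "(\<lambda>n. V n /
      (ball_moment DIM('a) (2 * \<beta>) / 2 * sq_integral * (real n ^ 2 * r n powr (2 * \<beta> + real DIM('a))) +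
       (ball_moment DIM('a) \<beta>)\<^sup>2 * (cube_integral - sq_integral\<^sup>2) * (real n ^ 3 * r n powr (2 * \<beta> + 2 * real DIM('a))))) \<longlonglongrightarrow> 1"
proof (rule quotient_of_combinations_tendsto_1[OF coefficient_tendsto(1,2)[OF \<beta> r]])
  have "ball_moment DIM('a) (2 * \<beta>) > 0" "ball_moment DIM('a) \<beta> > 0"
    using \<beta> by (auto simp: ball_moment_def intro!: divide_pos_pos mult_pos_pos)
  then show "ball_moment DIM('a) (2 * \<beta>) / 2 * sq_integral > 0" "(ball_moment DIM('a) \<beta>)\<^sup>2 * (cube_integral - sq_integral\<^sup>2) > 0"
    using sq_integral_pos cube_integral_ge F by auto
  show "V n = pair_coefficient \<beta> (r n) n * (real n ^ 2 * r n powr (2 * \<beta> + real DIM('a))) +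
      triple_coefficient \<beta> (r n) n * (real n ^ 3 * r n powr (2 * \<beta> + 2 * real DIM('a)))" if "n \<ge> 1" for n
    using V[OF that] variance_formula_eq[OF r(1) that] by simp
  show "real n ^ 2 * r n powr (2 * \<beta> + real DIM('a)) > 0"
    "real n ^ 3 * r n powr (2 * \<beta> + 2 * real DIM('a)) > 0" if "n \<ge> 1" for n
    using r(1)[of n] that by auto
qed

end

section \<open>Asymptotics for the uniform density\<close>

locale uniform_density = L3_density f for f :: "'a::euclidean_space \<Rightarrow> real" +
  fixes W :: "'a set"
  assumes W: "W \<in> sets lebesgue" "measure lebesgue W = 1"
    and f_eq: "AE x in lborel. f x = indicator W x"
begin

lemma W_finite: "emeasure lebesgue W = 1"
proof -
  have "emeasure lebesgue W \<noteq> \<infinity>"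
    using W(2) by (auto simp: measure_def)
  then show ?thesis using W(2) by (simp add: emeasure_eq_ennreal_measure)
qed

lemma sq_integral_eq_1: "sq_integral = 1"
proof -
  have "sq_integral = (LINT x|lborel. f x)"
    unfolding sq_integral_def by (rule integral_cong_AE) (use f_eq in \<open>auto elim!: eventually_mono simp: indicator_def power2_eq_square\<close>)
  then show ?thesis by (simp add: f_integral)
qed

lemma potential_le:
  assumes r: "r > 0" and \<gamma>: "2 * \<gamma> > - real DIM('a)"
  shows "potential \<gamma> r x \<le> kernel_mass DIM('a) \<gamma> r"
proof -
  have \<gamma>': "\<gamma> > - real DIM('a)" using \<gamma> by simp
  have "potential \<gamma> r x \<le> (LINT y|lborel. power_kernel \<gamma> r (x - y))"
    unfolding potential_def
    by (rule integral_mono_AE[OF potential_integrable[OF assms] kernel_translate(1)[OF r \<gamma>']])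
       (use f_eq in \<open>auto elim!: eventually_mono simp: indicator_def\<close>)
  then show ?thesis by (simp add: kernel_translate(2)[OF r \<gamma>'])
qed

text \<open>The closed ball around \<open>x\<close> is connected and meets \<open>W\<close>, so it could leave \<open>W\<close> only through
  the frontier, which is too far away.\<close>

lemma potential_eq:
  assumes r: "r > 0" and \<gamma>: "\<gamma> > - real DIM('a)" and x: "x \<in> W" "infdist x (frontier W) > r"
  shows "potential \<gamma> r x = kernel_mass DIM('a) \<gamma> r"
proof -
  have sub: "cball x r \<subseteq> W"
  proof (rule ccontr)
    assume "\<not> cball x r \<subseteq> W"
    then have "cball x r \<inter> frontier W \<noteq> {}"
    proof (intro connected_Int_frontier)
      show "cball x r \<inter> W \<noteq> {}" using x(1) r by (auto intro!: exI[of _ x] simp: disjoint_iff)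
    qed auto
    then obtain y where "y \<in> frontier W" "dist x y \<le> r" by auto
    then show False using infdist_le[of y "frontier W" x] x(2) by simp
  qed
  have "potential \<gamma> r x = (LINT y|lborel. power_kernel \<gamma> r (x - y))"
    unfolding potential_def
  proof (rule integral_cong_AE)
    show "AE y in lborel. power_kernel \<gamma> r (x - y) * f y = power_kernel \<gamma> r (x - y)"
      using f_eq
    proof eventually_elim
      case (elim y)
      show ?case
      proof (cases "norm (x - y) \<le> r")
        case True
        then have "y \<in> W" using sub by (auto simp: dist_norm)
        then show ?thesis using elim by simp
      qed (simp add: power_kernel_def)
    qed
  qed measurable
  then show ?thesis by (simp add: kernel_translate(2)[OF r \<gamma>])
qed

text \<open>The difference is the variance of the potential at a uniform point of \<open>W\<close>, hence at most the
  second moment about its upper bound. Only points of the boundary layer contribute to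
  the latter.\<close>

lemma triple_minus_pair_sq:
  assumes r: "r > 0" and \<gamma>: "2 * \<gamma> > - real DIM('a)"
  shows "0 \<le> triple_integral \<gamma> r - (pair_integral \<gamma> r)\<^sup>2"
    and "triple_integral \<gamma> r - (pair_integral \<gamma> r)\<^sup>2 \<le>
      (kernel_mass DIM('a) \<gamma> r)\<^sup>2 * measure lebesgue {x \<in> W. infdist x (frontier W) \<le> r}"
proof -
  have \<gamma>': "\<gamma> > - real DIM('a)" using \<gamma> by simp
  let ?Q = "\<lambda>c. LINT x|lborel. (potential \<gamma> r x - c)\<^sup>2 * f x"
  note Q = potential_centered_second_moment[OF r \<gamma>]
  define G where "G = kernel_mass DIM('a) \<gamma> r"
  define B where "B = {x \<in> W. infdist x (frontier W) \<le> r}"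
  have "?Q (pair_integral \<gamma> r) = triple_integral \<gamma> r - (pair_integral \<gamma> r)\<^sup>2"
    unfolding Q(2) by (simp add: power2_eq_square)
  moreover have "?Q (pair_integral \<gamma> r) \<ge> 0"
    by (intro Bochner_Integration.integral_nonneg) (simp add: f_nonneg)
  ultimately show "0 \<le> triple_integral \<gamma> r - (pair_integral \<gamma> r)\<^sup>2" by simp
  have "triple_integral \<gamma> r - (pair_integral \<gamma> r)\<^sup>2 \<le> ?Q G"
  proof -
    have "?Q G = (triple_integral \<gamma> r - (pair_integral \<gamma> r)\<^sup>2) + (G - pair_integral \<gamma> r)\<^sup>2"
      unfolding Q(2) by (simp add: power2_eq_square algebra_simps)
    then show ?thesis by simp
  qed
  also have "?Q G = (LINT x|lebesgue. (potential \<gamma> r x - G)\<^sup>2 * f x)"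
    by (rule integral_completion[symmetric]) measurable
  also have "\<dots> \<le> (LINT x|lebesgue. G\<^sup>2 * indicator B x)"
  proof (rule integral_mono_AE)
    have Bm: "B \<in> sets lebesgue"
    proof -
      have "closed {x. infdist x (frontier W) \<le> r}"
        by (intro closed_Collect_le continuous_intros)
      then have "W \<inter> {x. infdist x (frontier W) \<le> r} \<in> sets lebesgue"
        by (intro sets.Int W(1)) (auto intro: borel_closed)
      then show ?thesis by (simp add: B_def Collect_conj_eq)
    qed
    have "emeasure lebesgue B \<le> emeasure lebesgue W"
      by (rule emeasure_mono) (auto simp: B_def W)
    then have "emeasure lebesgue B < \<infinity>" using W_finite by (auto intro: le_less_trans)
    then show "integrable lebesgue (\<lambda>x. G\<^sup>2 * indicator B x)" using Bm by auto
    show "integrable lebesgue (\<lambda>x. (potential \<gamma> r x - G)\<^sup>2 * f x)"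
      using Q(1)[of G] by (subst integrable_completion) auto
    show "AE x in lebesgue. (potential \<gamma> r x - G)\<^sup>2 * f x \<le> G\<^sup>2 * indicator B x"
      using AE_completion[OF f_eq]
    proof eventually_elim
      case (elim x)
      have "(potential \<gamma> r x - G)\<^sup>2 \<le> G\<^sup>2"
        using potential_le[OF r \<gamma>, of x] potential_nonneg[of \<gamma> r x] unfolding G_def
        by (intro abs_le_square_iff[THEN iffD1]) auto
      moreover have "potential \<gamma> r x = G" if "x \<in> W" "x \<notin> B"
        using potential_eq[OF r \<gamma>', of x] that by (auto simp: B_def G_def)
      ultimately show ?case using elim by (auto simp: indicator_def B_def)
    qed
  qed
  also have "\<dots> = G\<^sup>2 * measure lebesgue B" by simp
  finally show "triple_integral \<gamma> r - (pair_integral \<gamma> r)\<^sup>2 \<le> (kernel_mass DIM('a) \<gamma> r)\<^sup>2 *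
    measure lebesgue {x \<in> W. infdist x (frontier W) \<le> r}" unfolding G_def B_def .
qed

text \<open>The pair term dominates. In the cubic term the variance of the potential is of relative order
  \<open>r\<close>, which \<open>n r\<^sup>d\<^sup>+\<^sup>1 \<rightarrow> 0\<close> makes negligible; the difference between the numbers of
  pairs in the last two terms of the variance leaves a remainder of order \<open>r\<^sup>d\<close>.\<close>

lemma variance_formula_asymp_uniform:
  fixes r :: "nat \<Rightarrow> real"
  assumes \<beta>: "\<beta> > - real DIM('a) / 2" and r: "\<And>n. r n > 0" "r \<longlonglongrightarrow> 0"
    and bd: "Limsup (at_right 0) (\<lambda>s::real. ereal (measure lebesgue {x \<in> W. infdist x (frontier W) \<le> s} / s)) < \<infinity>"
    and nr: "(\<lambda>n. real n * r n ^ (DIM('a) + 1)) \<longlonglongrightarrow> 0"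
    and V: "\<And>n. n \<ge> 1 \<Longrightarrow> V n = variance_formula \<beta> (r n) n"
  shows "(\<lambda>n. V n / (real n ^ 2 * r n powr (2 * \<beta> + real DIM('a)))) \<longlonglongrightarrow> ball_moment DIM('a) (2 * \<beta>) / 2"
proof -
  have \<beta>': "2 * \<beta> > - real DIM('a)" using \<beta> by auto
  let ?m = "\<lambda>s. measure lebesgue {x \<in> W. infdist x (frontier W) \<le> s}"
  have fr: "filterlim r (at_right 0) sequentially"
    by (rule tendsto_imp_filterlim_at_right[OF r(2)]) (simp add: r(1))
  obtain N :: nat where "Limsup (at_right 0) (\<lambda>s::real. ereal (?m s / s)) < ereal (real N)"
    using bd less_PInf_Ex_of_nat by auto
  then have "\<forall>\<^sub>F s in at_right 0. ereal (?m s / s) < ereal (real N)" by (rule Limsup_lessD)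
  then have evN: "\<forall>\<^sub>F n in sequentially. ereal (?m (r n) / r n) < ereal (real N)"
    using fr by (rule eventually_compose_filterlim)
  define q where "q n = r n powr (\<beta> + real DIM('a))" for n
  have q: "q n > 0" for n using r(1)[of n] by (simp add: q_def)
  define b where "b = ball_moment DIM('a) \<beta>"
  define P where "P n = pair_integral \<beta> (r n) / q n" for n
  define T where "T n = triple_integral \<beta> (r n) / (q n)\<^sup>2" for n
  have TP: "0 \<le> T n - (P n)\<^sup>2" "T n - (P n)\<^sup>2 \<le> b\<^sup>2 * ?m (r n)" for n
  proof -
    have e: "T n - (P n)\<^sup>2 = (triple_integral \<beta> (r n) - (pair_integral \<beta> (r n))\<^sup>2) / (q n)\<^sup>2"
      by (simp add: T_def P_def power_divide diff_divide_distrib)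
    show "0 \<le> T n - (P n)\<^sup>2"
      unfolding e using triple_minus_pair_sq(1)[OF r(1) \<beta>'] by simp
    show "T n - (P n)\<^sup>2 \<le> b\<^sup>2 * ?m (r n)"
      unfolding e using triple_minus_pair_sq(2)[OF r(1)[of n] \<beta>'] q[of n]
      by (simp add: pos_divide_le_eq kernel_mass_def q_def[symmetric] b_def power_mult_distrib mult_ac)
  qed
  \<comment> \<open>Since \<open>n - 3/2 = (n - 2) + 1/2\<close>, the cubic term relative to \<open>n\<^sup>2 r\<^sup>2\<^sup>\<beta>\<^sup>+\<^sup>d\<close> is \<open>X - Y\<close>.\<close>
  define X where "X n = (real n - 1) * (real n - 2) / (real n)\<^sup>2 * (T n - (P n)\<^sup>2) * (real n * r n ^ DIM('a))" for n
  define Y where "Y n = (real n - 1) / (2 * real n) * (P n)\<^sup>2 * r n ^ DIM('a)" for n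
  have "X \<longlonglongrightarrow> 0"
  proof (rule Lim_null_comparison)
    show "(\<lambda>n. b\<^sup>2 * real N * (real n * r n ^ (DIM('a) + 1))) \<longlonglongrightarrow> 0"
      using tendsto_mult[OF tendsto_const nr] by simp
    show "\<forall>\<^sub>F n in sequentially. norm (X n) \<le> b\<^sup>2 * real N * (real n * r n ^ (DIM('a) + 1))"
      using evN eventually_ge_at_top[of 2]
    proof eventually_elim
      case (elim n)
      have rn: "r n > 0" by (rule r)
      have m: "?m (r n) \<le> real N * r n" using elim(1) rn by (simp add: pos_divide_less_eq)
      have c: "0 \<le> (real n - 1) * (real n - 2) / (real n)\<^sup>2" "(real n - 1) * (real n - 2) / (real n)\<^sup>2 \<le> 1"
      proof -
        have "real n \<ge> 2" using elim(2) by simp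
        then show "0 \<le> (real n - 1) * (real n - 2) / (real n)\<^sup>2"
          by (intro divide_nonneg_nonneg mult_nonneg_nonneg) auto
        show "(real n - 1) * (real n - 2) / (real n)\<^sup>2 \<le> 1"
          using \<open>real n \<ge> 2\<close> by (simp add: divide_le_eq power2_eq_square algebra_simps)
      qed
      have "X n \<ge> 0" unfolding X_def using c(1) TP(1)[of n] rn by (intro mult_nonneg_nonneg) auto
      moreover have "X n \<le> 1 * (b\<^sup>2 * (real N * r n)) * (real n * r n ^ DIM('a))"
        unfolding X_def
      proof (intro mult_right_mono mult_mono)
        show "T n - (P n)\<^sup>2 \<le> b\<^sup>2 * (real N * r n)"
          using TP(2)[of n] mult_left_mono[OF m, of "b\<^sup>2"] by simp
      qed (use c TP(1)[of n] rn in auto)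
      ultimately show ?case by (simp add: mult_ac)
    qed
  qed
  moreover have "Y \<longlonglongrightarrow> 0"
  proof -
    have "Y \<longlonglongrightarrow> (1 / 2) * (b * sq_integral)\<^sup>2 * 0 ^ DIM('a)"
      unfolding Y_def P_def q_def b_def
      by (intro tendsto_mult tendsto_power coefficient_tendsto(3) \<beta> r) real_asymp
    then show ?thesis by (simp add: power_0_left)
  qed
  ultimately have "(\<lambda>n. pair_coefficient \<beta> (r n) n + X n - Y n) \<longlonglongrightarrow> ball_moment DIM('a) (2 * \<beta>) / 2 * sq_integral + 0 - 0"
    by (intro tendsto_intros coefficient_tendsto(1) \<beta> r)
  then have lim: "(\<lambda>n. pair_coefficient \<beta> (r n) n + X n - Y n) \<longlonglongrightarrow> ball_moment DIM('a) (2 * \<beta>) / 2"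
    by (simp add: sq_integral_eq_1)
  show ?thesis
  proof (rule Lim_transform_eventually[OF lim])
    show "\<forall>\<^sub>F n in sequentially. pair_coefficient \<beta> (r n) n + X n - Y n = V n / (real n ^ 2 * r n powr (2 * \<beta> + real DIM('a)))"
      using eventually_ge_at_top[of 1]
    proof eventually_elim
      case (elim n)
      define p where "p = r n powr (2 * \<beta> + real DIM('a))"
      have p: "p > 0" using r(1)[of n] by (simp add: p_def)
      have rp: "r n powr (2 * \<beta> + 2 * real DIM('a)) = p * r n ^ DIM('a)"
        using r(1)[of n] by (simp add: p_def powr_add[symmetric] powr_realpow[symmetric] add_ac)
      have c3: "triple_coefficient \<beta> (r n) n * (real n * r n ^ DIM('a)) = X n - Y n"
        unfolding triple_coefficient_def X_def Y_def T_def[unfolded q_def, symmetric] P_def[unfolded q_def, symmetric]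
        using elim by (simp add: field_simps power2_eq_square)
      have "V n = pair_coefficient \<beta> (r n) n * (real n ^ 2 * p) + triple_coefficient \<beta> (r n) n * (real n * r n ^ DIM('a)) * (real n ^ 2 * p)"
        unfolding V[OF elim] variance_formula_eq[OF r(1) elim] rp p_def[symmetric]
        by (simp add: power2_eq_square power3_eq_cube)
      then show ?case
        unfolding c3 p_def[symmetric] using p elim by (simp add: field_simps)
    qed
  qed
qed

end

section \<open>Reduction to Borel integrals over the whole space\<close>

text \<open>For a Borel function that vanishes off \<open>A\<close> neither the completion nor the restriction matters.\<close>

lemma set_integral_lebesgue_eq_lborel:
  fixes F :: "'b::euclidean_space \<Rightarrow> real"
  assumes "F \<in> borel_measurable borel" "\<And>x. x \<notin> A \<Longrightarrow> F x = 0"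
  shows "(LINT x:A|lebesgue. F x) = (LINT x|lborel. F x)"
proof -
  have "(LINT x:A|lebesgue. F x) = (LINT x|lebesgue. F x)"
    unfolding set_lebesgue_integral_def
    by (rule Bochner_Integration.integral_cong) (use assms(2) in \<open>auto simp: indicator_def\<close>)
  also have "\<dots> = (LINT x|lborel. F x)"
    by (rule integral_completion) (use assms(1) in simp)
  finally show ?thesis .
qed

lemma square_le_add_cube:
  fixes a :: real
  assumes "a \<ge> 0" shows "a\<^sup>2 \<le> a + a ^ 3"
proof -
  have "0 \<le> a * ((1 - a)\<^sup>2 + a)" using assms by simp
  also have "\<dots> = a + a ^ 3 - a\<^sup>2" by (simp add: power2_eq_square power3_eq_cube algebra_simps)
  finally show ?thesis by simp
qed

lemma L3_density_if_Lp_on: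
  fixes f :: "'a::euclidean_space \<Rightarrow> real"
  assumes f: "prob_density f" and supp: "{x. f x \<noteq> 0} \<subseteq> W" and L3: "f \<in> Lp_on 3 W"
  shows "L3_density f"
proof
  show [measurable]: "f \<in> borel_measurable borel" and nn: "0 \<le> f x" and p: "(\<integral>\<^sup>+x. ennreal (f x) \<partial>lborel) = 1" for x
    using f by (auto simp: prob_density_def)
  have i1: "integrable lborel f"
    by (rule integrableI_nonneg) (use p nn in auto)
  have "integrable lebesgue (\<lambda>x. indicator W x *\<^sub>R (\<bar>f x\<bar> powr 3))"
    using L3 by (simp add: Lp_on_def set_integrable_def)
  also have "(\<lambda>x. indicator W x *\<^sub>R (\<bar>f x\<bar> powr 3)) = (\<lambda>x. f x ^ 3)"
  proof
    fix x show "indicator W x *\<^sub>R (\<bar>f x\<bar> powr 3) = f x ^ 3"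
      using supp nn[of x] powr_numeral[of "f x" "num.Bit1 num.One"] by (cases "f x = 0") (auto simp: indicator_def)
  qed
  finally show i3: "integrable lborel (\<lambda>x. f x ^ 3)"
    by (subst (asm) integrable_completion) auto
  show "integrable lborel (\<lambda>x. (f x)\<^sup>2)"
  proof (rule Bochner_Integration.integrable_bound)
    show "integrable lborel (\<lambda>x. f x + f x ^ 3)" using i1 i3 by simp
    show "AE x in lborel. norm ((f x)\<^sup>2) \<le> norm (f x + f x ^ 3)"
      using square_le_add_cube nn by (intro AE_I2) simp
  qed measurable
qed

context L3_density
begin

lemma set_integrals:
  assumes supp: "{x. f x \<noteq> 0} \<subseteq> W"
  shows "(LINT (x, y):W \<times> W|lebesgue. of_bool (norm (x - y) \<le> r) * norm (x - y) powr \<gamma> * f x * f y) = pair_integral \<gamma> r"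
    and "(LINT x:W|lebesgue. (LINT y:W|lebesgue. of_bool (norm (x - y) \<le> r) * norm (x - y) powr \<gamma> * f y)\<^sup>2 * f x) = triple_integral \<gamma> r"
    and "(LINT x:W|lebesgue. f x ^ 2) = sq_integral" "(LINT x:W|lebesgue. f x ^ 3) = cube_integral"
proof -
  have z: "f x = 0" if "x \<notin> W" for x using supp that by auto
  show "(LINT (x, y):W \<times> W|lebesgue. of_bool (norm (x - y) \<le> r) * norm (x - y) powr \<gamma> * f x * f y) = pair_integral \<gamma> r"
    unfolding pair_integral_def lborel_prod power_kernel_def
  proof (rule set_integral_lebesgue_eq_lborel)
    have "(\<lambda>(x, y). of_bool (norm (x - y) \<le> r) * norm (x - y) powr \<gamma> * f x * f y) \<in> borel_measurable (borel \<Otimes>\<^sub>M borel)"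
      by measurable
    then show "(\<lambda>(x, y). of_bool (norm (x - y) \<le> r) * norm (x - y) powr \<gamma> * f x * f y) \<in> borel_measurable borel"
      unfolding borel_prod .
  qed (use z in \<open>auto split: prod.splits\<close>)
  have i: "(LINT y:W|lebesgue. of_bool (norm (x - y) \<le> r) * norm (x - y) powr \<gamma> * f y) = potential \<gamma> r x" for x
    unfolding potential_def power_kernel_def
    by (rule set_integral_lebesgue_eq_lborel) (use z in auto)
  show "(LINT x:W|lebesgue. (LINT y:W|lebesgue. of_bool (norm (x - y) \<le> r) * norm (x - y) powr \<gamma> * f y)\<^sup>2 * f x) = triple_integral \<gamma> r"
    unfolding i triple_integral_def by (rule set_integral_lebesgue_eq_lborel) (use z in auto)
  show "(LINT x:W|lebesgue. f x ^ 2) = sq_integral" "(LINT x:W|lebesgue. f x ^ 3) = cube_integral"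
    unfolding sq_integral_def cube_integral_def by (rule set_integral_lebesgue_eq_lborel; use z in auto)+
qed

text \<open>A density that is constant on its support \<open>A\<close> is the uniform density on \<open>A\<close>. Either \<open>A\<close> has
  smaller volume than \<open>W\<close>, or it fills \<open>W\<close> up to a null set.\<close>

lemma cube_integral_eq_imp_uniform:
  assumes supp: "{x. f x \<noteq> 0} \<subseteq> W" and W: "W \<in> sets lebesgue" "measure lebesgue W = 1"
    and eq: "cube_integral = sq_integral\<^sup>2"
  shows "ae_eq_on W f (indicator W) \<or> uniform_on_smaller_subset W f"
proof -
  define A where "A = {x. f x \<noteq> 0}"
  have [measurable]: "A \<in> sets borel" unfolding A_def by measurable
  have AW: "A \<subseteq> W" using supp by (simp add: A_def)
  have Wf: "emeasure lebesgue W \<noteq> \<infinity>" using W(2) by (auto simp: measure_def)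
  have Wm: "W \<in> lmeasurable" using W(1) Wf by (auto intro: fmeasurableI simp: less_top)
  have Am: "A \<in> lmeasurable"
    by (rule fmeasurableI2[OF Wm AW]) simp
  have fA: "AE x in lborel. f x = sq_integral * indicator A x"
    using cube_integral_eq_imp[OF eq] by eventually_elim (auto simp: A_def indicator_def)
  have "1 = (LINT x|lborel. sq_integral * indicator A x)"
    unfolding f_integral[symmetric] by (rule integral_cong_AE[OF _ _ fA]) measurable
  then have FA: "sq_integral * measure lebesgue A = 1" by simp
  then have "measure lebesgue A \<noteq> 0" by auto
  then have sq_integral: "sq_integral = 1 / measure lebesgue A" using FA by (simp add: nonzero_eq_divide_eq)
  have fA': "AE x in lebesgue. f x = indicator A x / measure lebesgue A"
    using AE_completion[OF fA] by (simp add: sq_integral)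
  have le: "measure lebesgue A \<le> measure lebesgue W"
    by (rule measure_mono_fmeasurable[OF AW _ Wm]) simp
  show ?thesis
  proof (cases "measure lebesgue A < measure lebesgue W")
    case True
    have "ae_eq_on W f (\<lambda>x. indicator A x / measure lebesgue A)"
      unfolding ae_eq_on_def using fA' by eventually_elim simp
    then have "uniform_on_smaller_subset W f"
      unfolding uniform_on_smaller_subset_def using True AW by (intro exI[of _ A]) auto
    then show ?thesis ..
  next
    case False
    then have A1: "measure lebesgue A = 1" using le W(2) by simp
    have "measure lebesgue (W - A) = 0"
      using measurable_measure_Diff[OF Wm _ AW] A1 W(2) Am by simp
    then have "W - A \<in> null_sets lebesgue"
      using Wm Am by (auto simp: null_sets_def emeasure_eq_measure2 fmeasurable.Diff)
    then have "AE x in lebesgue. x \<notin> W - A" by (rule AE_not_in)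
    with fA' have "AE x in lebesgue. x \<in> W \<longrightarrow> f x = indicator W x"
      by eventually_elim (auto simp: A1)
    then show ?thesis unfolding ae_eq_on_def by blast
  qed
qed

end

theorem theorem2p3:
  fixes W :: "'a::euclidean_space set"
    and f :: "'a \<Rightarrow> real"
    and M :: "'w measure"
    and X :: "nat \<Rightarrow> 'w \<Rightarrow> 'a"
    and r :: "nat \<Rightarrow> real"
    and \<beta> :: real
  assumes W_meas: "W \<in> sets lebesgue"
    and W_vol: "measure lebesgue W = 1"
    and f_density: "prob_density f"
    and f_support: "{x. f x \<noteq> 0} \<subseteq> W"
    and M_prob: "prob_space M"
    and X_indep: "prob_space.indep_vars M (\<lambda>_. borel) X {1..}"
    and X_density: "\<And>i. i \<ge> 1 \<Longrightarrow> distributed M lborel (X i) (\<lambda>x. ennreal (f x))"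
    and r_pos: "\<And>n. r n > 0"
    and r_lim: "r \<longlonglongrightarrow> 0"
    and f_L3: "f \<in> Lp_on 3 W"
    and beta: "\<beta> > - real DIM('a) / 2"
  shows
    "(\<forall>n\<ge>2.
        integrable M (\<lambda>\<omega>. (length_power \<beta> (r n) (point_sample X n \<omega>))\<^sup>2) \<and>
        prob_space.variance M (\<lambda>\<omega>. length_power \<beta> (r n) (point_sample X n \<omega>)) =
          real n * (real n - 1) / 2 *
            (LINT (x, y):W \<times> W|lebesgue.
               of_bool (norm (x - y) \<le> r n) * norm (x - y) powr (2 * \<beta>) * f x * f y)
          + real n * (real n - 1) * (real n - 2) *
            (LINT x:W|lebesgue.
               (LINT y:W|lebesgue.
                  of_bool (norm (x - y) \<le> r n) * norm (x - y) powr \<beta> * f y)\<^sup>2 * f x)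
          - real n * (real n - 1) * (real n - 3 / 2) *
            (LINT (x, y):W \<times> W|lebesgue.
               of_bool (norm (x - y) \<le> r n) * norm (x - y) powr \<beta> * f x * f y)\<^sup>2)
     \<and>
     (\<not> ae_eq_on W f (indicator W) \<and> \<not> uniform_on_smaller_subset W f \<longrightarrow>
        (\<lambda>n. prob_space.variance M (\<lambda>\<omega>. length_power \<beta> (r n) (point_sample X n \<omega>)) /
             (sigma1 \<beta> W f * real n ^ 2 * r n powr (2 * \<beta> + real DIM('a)) +
              sigma2 \<beta> W f * real n ^ 3 * r n powr (2 * \<beta> + 2 * real DIM('a))))
        \<longlonglongrightarrow> 1)
     \<and>
     (ae_eq_on W f (indicator W) \<and>
      Limsup (at_right 0)
        (\<lambda>s::real. ereal (measure lebesgue {x \<in> W. infdist x (frontier W) \<le> s} / s)) < \<infinity> \<and>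
      (\<lambda>n. real n * r n ^ (DIM('a) + 1)) \<longlonglongrightarrow> 0 \<longrightarrow>
        (\<lambda>n. prob_space.variance M (\<lambda>\<omega>. length_power \<beta> (r n) (point_sample X n \<omega>)) /
             (real n ^ 2 * r n powr (2 * \<beta> + real DIM('a))))
        \<longlonglongrightarrow> real DIM('a) * unit_ball_vol (real DIM('a)) / (2 * (2 * \<beta> + real DIM('a))))"
proof -
  interpret L3_density f by (rule L3_density_if_Lp_on[OF f_density f_support f_L3])
  let ?V = "\<lambda>n. prob_space.variance M (\<lambda>\<omega>. length_power \<beta> (r n) (point_sample X n \<omega>))"
  have X_distr: "distr M borel (X i) = density lborel (\<lambda>x. ennreal (f x))" if "i \<ge> 1" for i
    using distributed_distr_eq_density[OF X_density[OF that]]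
    by (metis distr_cong sets_lborel)
  note V = variance_length_power[OF M_prob X_indep X_distr r_pos beta]
  have Vf: "?V n = variance_formula \<beta> (r n) n" for n
    unfolding variance_formula_def by (rule V(2))
  have a: "\<forall>n\<ge>2.
      integrable M (\<lambda>\<omega>. (length_power \<beta> (r n) (point_sample X n \<omega>))\<^sup>2) \<and>
      ?V n = real n * (real n - 1) / 2 * pair_integral (2 * \<beta>) (r n)
        + real n * (real n - 1) * (real n - 2) * triple_integral \<beta> (r n)
        - real n * (real n - 1) * (real n - 3 / 2) * (pair_integral \<beta> (r n))\<^sup>2"
    using V by blast
  have b: "(\<lambda>n. ?V n /
      (sigma1 \<beta> W f * real n ^ 2 * r n powr (2 * \<beta> + real DIM('a)) +
       sigma2 \<beta> W f * real n ^ 3 * r n powr (2 * \<beta> + 2 * real DIM('a)))) \<longlonglongrightarrow> 1"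
    if "\<not> ae_eq_on W f (indicator W) \<and> \<not> uniform_on_smaller_subset W f"
  proof -
    have "cube_integral \<noteq> sq_integral\<^sup>2" using cube_integral_eq_imp_uniform[OF f_support W_meas W_vol] that by blast
    note lim = variance_formula_asymp_nonuniform[OF beta r_pos r_lim this, of ?V, OF Vf]
    have sig: "sigma1 \<beta> W f = ball_moment DIM('a) (2 * \<beta>) / 2 * sq_integral"
      "sigma2 \<beta> W f = (ball_moment DIM('a) \<beta>)\<^sup>2 * (cube_integral - sq_integral\<^sup>2)"
      by (simp_all add: sigma1_def sigma2_def ball_moment_def set_integrals[OF f_support] power_divide power_mult_distrib)
    show ?thesis using lim unfolding sig by (simp only: mult.assoc)
  qed
  have c: "(\<lambda>n. ?V n / (real n ^ 2 * r n powr (2 * \<beta> + real DIM('a))))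
      \<longlonglongrightarrow> real DIM('a) * unit_ball_vol (real DIM('a)) / (2 * (2 * \<beta> + real DIM('a)))"
    if "ae_eq_on W f (indicator W)"
      "Limsup (at_right 0) (\<lambda>s::real. ereal (measure lebesgue {x \<in> W. infdist x (frontier W) \<le> s} / s)) < \<infinity>"
      "(\<lambda>n. real n * r n ^ (DIM('a) + 1)) \<longlonglongrightarrow> 0"
  proof -
    have "AE x in lebesgue. f x = indicator W x"
      using that(1) f_support unfolding ae_eq_on_def
      by (auto elim!: eventually_mono simp: indicator_def)
    then have "AE x in lborel. f x = indicator W x" by (simp only: AE_completion_iff)
    then interpret uniform_density f W
      by unfold_locales (use W_meas W_vol in auto)
    show ?thesis
      using variance_formula_asymp_uniform[OF beta r_pos r_lim that(2,3), of ?V, OF Vf]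
      by (simp add: ball_moment_def mult.commute)
  qed
  show ?thesis
    unfolding set_integrals[OF f_support] using a b c by blast
qed

end
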